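(* The positive cone functor $P \colon \mathsf{PreOrdGrp} \rightarrow \mathsf{Mon}_{\geq 0}$ is a torsion theory functor (from the pretorsion theory $(\mathsf{Grp(PreOrd)},\mathsf{ParOrdGrp})$ in $\mathsf{PreOrdGrp}$ to the torsion theory $(\mathsf{Grp},\mathsf{Red}\mathsf{Mon}_{\geq 0})$ in $\mathsf{Mon}_{\geq 0}$).
   Context: Groups and monoids are written additively but need not be commutative. $\mathsf{PreOrdGrp}$ is the category of preordered groups: objects are pairs $(G,P_G)$ with $G$ a group and $P_G$ a submonoid of $G$ closed under conjugation in $G$ (the positive cone); a morphism $(f,\bar f)\colon (G,P_G)\to(H,P_H)$ is a group morphism $f\colon G\to H$ with $f(P_G)\subseteq P_H$, and $\bar f\colon P_G\to P_H$ is its restriction. $\mathsf{Grp(PreOrd)}$ is the full subcategory of those $(G,P_G)$ with $P_G$ a group; $\mathsf{ParOrdGrp}$ is the full subcategory of those $(G,P_G)$ with $P_G$ reduced (the only $x\in P_G$ with $-x\in P_G$ is $0$). This pair is a pretorsion theory in $\mathsf{PreOrdGrp}$, with class of trivial objects $\mathscr{Z}=\{(G,P_G)\mid P_G=0\}$. The canonical short $\mathscr{Z}$-exact sequence of $(G,P_G)$ is $$(G,N_G)\longrightarrow (G,P_G)\longrightarrow (G/N_G,\eta_G(P_G)),$$ where $N_G=\{x\in G\mid x\in P_G \text{ and } -x\in P_G\}$ (a normal subgroup of $G$), the first arrow is $1_G$ on underlying groups, and the second is the quotient morphism $\eta_G\colon G\twoheadrightarrow G/N_G$. $\mathsf{Mon}_{\geq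 0}$ is the full subcategory of the category of monoids whose objects are the monoids $M$ that are embeddable in a group and such that for all $a,b\in M$ there exist $x,y\in M$ with $a+b=b+x=y+a$. It is pointed, with zero object the trivial monoid $0$. $\mathsf{Grp}$ is its full subcategory of objects that are groups, $\mathsf{Red}\mathsf{Mon}_{\geq 0}$ its full subcategory of objects that are reduced monoids (only invertible element is $0$); the pair $(\mathsf{Grp},\mathsf{Red}\mathsf{Mon}_{\geq 0})$ is a torsion theory in $\mathsf{Mon}_{\geq 0}$. The positive cone functor $P$ is given by $P(G,P_G)=P_G$ and $P(f,\bar f)=\bar f$. In a pointed category, a short exact sequence is a composable pair $(k,q)$ such that $k$ is a kernel of $q$ and $q$ is a cokernel of $k$. A functor $\Phi\colon\mathsf{PreOrdGrp}\to\mathscr{S}$, where $\mathscr{S}$ is a pointed category with a torsion theory $(\mathscr{T},\mathscr{F})$, is a torsion theory functor if: $\Phi(G,P_G)\in\mathscr{T}$ for all $(G,P_G)\in\mathsf{Grp(PreOrd)}$; $\Phi(G,P_G)\in\mathscr{F}$ for all $(G,P_G)\in\mathsf{ParOrdGrp}$; and for every $(G,P_G)$, $\Phi$ sends the canonical short $\mathscr{Z}$-exact sequence of $(G,P_G)$ to a short exact sequence in $\mathscr{S}$. *)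

theory Defs
  imports "HOL-Algebra.Weak_Morphisms" "HOL-Algebra.Generated_Groups"
begin

section \<open>Categories\<close>

record ('o, 'm) cat =
  Obj :: "'o set"
  Arr :: "'m set"
  Dom :: "'m \<Rightarrow> 'o"
  Cod :: "'m \<Rightarrow> 'o"
  Id :: "'o \<Rightarrow> 'm"
  Comp :: "'m \<Rightarrow> 'm \<Rightarrow> 'm"  \<comment> \<open>\<open>Comp C g f\<close> is \<open>g\<close> after \<open>f\<close>\<close>

definition Hom :: "('o, 'm) cat \<Rightarrow> 'o \<Rightarrow> 'o \<Rightarrow> 'm set" where
  "Hom C A B = {f \<in> Arr C. Dom C f = A \<and> Cod C f = B}"

definition category :: "('o, 'm) cat \<Rightarrow> bool" where
  "category C \<longleftrightarrow>
     (\<forall>f\<in>Arr C. Dom C f \<in> Obj C \<and> Cod C f \<in> Obj C) \<and>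
     (\<forall>A\<in>Obj C. Id C A \<in> Hom C A A) \<and>
     (\<forall>f\<in>Arr C. \<forall>g\<in>Arr C. Cod C f = Dom C g \<longrightarrow>
        Comp C g f \<in> Hom C (Dom C f) (Cod C g)) \<and>
     (\<forall>f\<in>Arr C. Comp C f (Id C (Dom C f)) = f \<and> Comp C (Id C (Cod C f)) f = f) \<and>
     (\<forall>f\<in>Arr C. \<forall>g\<in>Arr C. \<forall>h\<in>Arr C. Cod C f = Dom C g \<longrightarrow> Cod C g = Dom C h \<longrightarrow>
        Comp C h (Comp C g f) = Comp C (Comp C h g) f)"

definition full_subcategory :: "('o, 'm) cat \<Rightarrow> 'o set \<Rightarrow> ('o, 'm) cat" where
  "full_subcategory C S =
     C\<lparr>Obj := Obj C \<inter> S, Arr := {f \<in> Arr C. Dom C f \<in> S \<and> Cod C f \<in> S}\<rparr>"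

definition iso_objects :: "('o, 'm) cat \<Rightarrow> 'o \<Rightarrow> 'o \<Rightarrow> bool" where
  "iso_objects C A B \<longleftrightarrow>
     (\<exists>f\<in>Hom C A B. \<exists>g\<in>Hom C B A. Comp C g f = Id C A \<and> Comp C f g = Id C B)"

definition zero_object :: "('o, 'm) cat \<Rightarrow> 'o \<Rightarrow> bool" where
  "zero_object C Z \<longleftrightarrow>
     Z \<in> Obj C \<and> (\<forall>A\<in>Obj C. (\<exists>!f. f \<in> Hom C A Z) \<and> (\<exists>!f. f \<in> Hom C Z A))"

definition pointed_category :: "('o, 'm) cat \<Rightarrow> bool" where
  "pointed_category C \<longleftrightarrow> category C \<and> (\<exists>Z. zero_object C Z)"

definition zero_arrow :: "('o, 'm) cat \<Rightarrow> 'm \<Rightarrow> bool" where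
  "zero_arrow C f \<longleftrightarrow>
     (\<exists>Z. zero_object C Z \<and>
        (\<exists>g\<in>Hom C (Dom C f) Z. \<exists>h\<in>Hom C Z (Cod C f). f = Comp C h g))"

definition is_kernel :: "('o, 'm) cat \<Rightarrow> 'm \<Rightarrow> 'm \<Rightarrow> bool" where
  "is_kernel C k q \<longleftrightarrow>
     k \<in> Arr C \<and> q \<in> Arr C \<and> Cod C k = Dom C q \<and> zero_arrow C (Comp C q k) \<and>
     (\<forall>h\<in>Arr C. Cod C h = Dom C q \<longrightarrow> zero_arrow C (Comp C q h) \<longrightarrow>
        (\<exists>!u. u \<in> Hom C (Dom C h) (Dom C k) \<and> Comp C k u = h))"

definition is_cokernel :: "('o, 'm) cat \<Rightarrow> 'm \<Rightarrow> 'm \<Rightarrow> bool" where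
  "is_cokernel C q k \<longleftrightarrow>
     q \<in> Arr C \<and> k \<in> Arr C \<and> Cod C k = Dom C q \<and> zero_arrow C (Comp C q k) \<and>
     (\<forall>h\<in>Arr C. Dom C h = Cod C k \<longrightarrow> zero_arrow C (Comp C h k) \<longrightarrow>
        (\<exists>!u. u \<in> Hom C (Cod C q) (Cod C h) \<and> Comp C u q = h))"

definition short_exact :: "('o, 'm) cat \<Rightarrow> 'm \<Rightarrow> 'm \<Rightarrow> bool" where
  "short_exact C k q \<longleftrightarrow> is_kernel C k q \<and> is_cokernel C q k"

definition replete :: "('o, 'm) cat \<Rightarrow> 'o set \<Rightarrow> bool" where
  "replete C S \<longleftrightarrow>
     S \<subseteq> Obj C \<and> (\<forall>A\<in>S. \<forall>B\<in>Obj C. iso_objects C A B \<longrightarrow> B \<in> S)"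

text \<open>The full subcategories \<open>T\<close> and \<open>F\<close> are given by their classes of objects.\<close>

definition torsion_theory :: "('o, 'm) cat \<Rightarrow> 'o set \<Rightarrow> 'o set \<Rightarrow> bool" where
  "torsion_theory C T F \<longleftrightarrow>
     replete C T \<and> replete C F \<and>
     (\<forall>A\<in>T. \<forall>B\<in>F. \<forall>f\<in>Hom C A B. zero_arrow C f) \<and>
     (\<forall>X\<in>Obj C. \<exists>k q. short_exact C k q \<and> Dom C k \<in> T \<and> Cod C k = X \<and> Cod C q \<in> F)"

definition is_functor ::
  "('o, 'm) cat \<Rightarrow> ('p, 'n) cat \<Rightarrow> ('o \<Rightarrow> 'p) \<Rightarrow> ('m \<Rightarrow> 'n) \<Rightarrow> bool" where
  "is_functor C D \<Phi>o \<Phi>a \<longleftrightarrow>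
     category C \<and> category D \<and>
     (\<forall>A\<in>Obj C. \<Phi>o A \<in> Obj D) \<and>
     (\<forall>f\<in>Arr C. \<Phi>a f \<in> Hom D (\<Phi>o (Dom C f)) (\<Phi>o (Cod C f))) \<and>
     (\<forall>A\<in>Obj C. \<Phi>a (Id C A) = Id D (\<Phi>o A)) \<and>
     (\<forall>f\<in>Arr C. \<forall>g\<in>Arr C. Cod C f = Dom C g \<longrightarrow>
        \<Phi>a (Comp C g f) = Comp D (\<Phi>a g) (\<Phi>a f))"

text \<open>
  Categories of structured sets over the universe \<open>'u\<close>: \<open>U A\<close> is the underlying set of \<open>A\<close>, and
  \<open>H A B\<close> is the set of structure-preserving maps. A morphism is a triple (domain, map, codomain)
  whose map is extensional, i.e. takes the value \<open>undefined\<close> outside the underlying set of the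
  domain, so that equality of morphisms is equality of maps on the domain.
\<close>

definition concrete_cat ::
  "'o set \<Rightarrow> ('o \<Rightarrow> 'u set) \<Rightarrow> ('o \<Rightarrow> 'o \<Rightarrow> ('u \<Rightarrow> 'u) set) \<Rightarrow> ('o, 'o \<times> ('u \<Rightarrow> 'u) \<times> 'o) cat" where
  "concrete_cat Ob U H =
     \<lparr>Obj = Ob,
      Arr = {(A, f, B). A \<in> Ob \<and> B \<in> Ob \<and> f \<in> H A B \<and> f \<in> extensional (U A)},
      Dom = (\<lambda>(A, f, B). A),
      Cod = (\<lambda>(A, f, B). B),
      Id = (\<lambda>A. (A, restrict (\<lambda>x. x) (U A), A)),
      Comp = (\<lambda>(B, g, C) (A, f, B'). (A, compose (U A) g f, C))\<rparr>"

section \<open>Monoids\<close>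

text \<open>Unlike group homomorphisms, the maps in \<open>hom M N\<close> need not preserve the unit.\<close>

definition monoid_homs :: "'a monoid \<Rightarrow> 'b monoid \<Rightarrow> ('a \<Rightarrow> 'b) set" where
  "monoid_homs M N = {f \<in> hom M N. f \<one>\<^bsub>M\<^esub> = \<one>\<^bsub>N\<^esub>}"

type_synonym 'u mon_arr = "'u monoid \<times> ('u \<Rightarrow> 'u) \<times> 'u monoid"

definition Mon :: "('u monoid, 'u mon_arr) cat" where
  "Mon = concrete_cat {M. monoid M} carrier monoid_homs"

text \<open>
  The type of the group is no restriction: a monoid over \<open>'a\<close> that embeds in a group over any
  type whatsoever generates a subgroup of it whose elements are named by words in \<open>'a\<close> with
  signs; see lemma \<open>embeddable_in_groupI\<close> below.
\<close>

definition embeddable_in_group :: "'a monoid \<Rightarrow> bool" where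
  "embeddable_in_group M \<longleftrightarrow> (\<exists>H :: (bool \<times> 'a) list monoid. group H \<and> mon M H \<noteq> {})"

definition MonGe0 :: "('u monoid, 'u mon_arr) cat" where
  "MonGe0 = full_subcategory Mon
     {M. embeddable_in_group M \<and>
         (\<forall>a\<in>carrier M. \<forall>b\<in>carrier M. \<exists>x\<in>carrier M. \<exists>y\<in>carrier M.
            a \<otimes>\<^bsub>M\<^esub> b = b \<otimes>\<^bsub>M\<^esub> x \<and> a \<otimes>\<^bsub>M\<^esub> b = y \<otimes>\<^bsub>M\<^esub> a)}"

definition GrpObj :: "'u monoid set" where
  "GrpObj = {M \<in> Obj MonGe0. group M}"

definition RedMonGe0Obj :: "'u monoid set" where
  "RedMonGe0Obj = {M \<in> Obj MonGe0. Units M = {\<one>\<^bsub>M\<^esub>}}"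

section \<open>Preordered groups\<close>

type_synonym 'u preord_grp = "'u monoid \<times> 'u set"
type_synonym 'u preord_grp_arr = "'u preord_grp \<times> ('u \<Rightarrow> 'u) \<times> 'u preord_grp"

definition preordered_group :: "'u preord_grp \<Rightarrow> bool" where
  "preordered_group = (\<lambda>(G, P). group G \<and> submonoid P G \<and>
     (\<forall>g\<in>carrier G. \<forall>p\<in>P. g \<otimes>\<^bsub>G\<^esub> p \<otimes>\<^bsub>G\<^esub> inv\<^bsub>G\<^esub> g \<in> P))"

definition preord_grp_homs :: "'u preord_grp \<Rightarrow> 'u preord_grp \<Rightarrow> ('u \<Rightarrow> 'u) set" where
  "preord_grp_homs = (\<lambda>(G, P) (H, Q). {f \<in> hom G H. f ` P \<subseteq> Q})"

text \<open>
  A morphism \<open>(f, f')\<close> is represented by \<open>f\<close> alone, since \<open>f'\<close> is its restriction.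
\<close>

definition PreOrdGrp :: "('u preord_grp, 'u preord_grp_arr) cat" where
  "PreOrdGrp = concrete_cat {X. preordered_group X} (\<lambda>(G, P). carrier G) preord_grp_homs"

definition pos_cone :: "'u preord_grp \<Rightarrow> 'u monoid" where
  "pos_cone = (\<lambda>(G, P). G\<lparr>carrier := P\<rparr>)"

definition pos_cone_arr :: "'u preord_grp_arr \<Rightarrow> 'u mon_arr" where
  "pos_cone_arr = (\<lambda>(X, f, Y). (pos_cone X, restrict f (carrier (pos_cone X)), pos_cone Y))"

definition GrpPreOrdObj :: "'u preord_grp set" where
  "GrpPreOrdObj = {X \<in> Obj PreOrdGrp. group (pos_cone X)}"

definition ParOrdGrpObj :: "'u preord_grp set" where
  "ParOrdGrpObj = {(G, P). (G, P) \<in> Obj PreOrdGrp \<and> (\<forall>x\<in>P. inv\<^bsub>G\<^esub> x \<in> P \<longrightarrow> x = \<one>\<^bsub>G\<^esub>)}"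

definition pos_neg :: "'u preord_grp \<Rightarrow> 'u set" where
  "pos_neg = (\<lambda>(G, P). {x \<in> carrier G. x \<in> P \<and> inv\<^bsub>G\<^esub> x \<in> P})"

text \<open>
  The library's quotient \<open>G Mod N\<close> has carrier type \<open>'u set\<close>. To have the quotient as an object
  over \<open>'u\<close> again, its structure is transported along the injection sending a coset to a chosen
  representative; \<open>coset_rep_iso\<close> below shows that this is an isomorphism.
\<close>

definition coset_rep :: "'u set \<Rightarrow> 'u" where
  "coset_rep K = (SOME x. x \<in> K)"

definition quotient_group :: "'u monoid \<Rightarrow> 'u set \<Rightarrow> 'u monoid" where
  "quotient_group G N = image_group coset_rep (G Mod N)"

definition quotient_map :: "'u monoid \<Rightarrow> 'u set \<Rightarrow> 'u \<Rightarrow> 'u" where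
  "quotient_map G N = (\<lambda>x\<in>carrier G. coset_rep (N #>\<^bsub>G\<^esub> x))"

definition canonical_mono :: "'u preord_grp \<Rightarrow> 'u preord_grp_arr" where
  "canonical_mono = (\<lambda>(G, P). ((G, pos_neg (G, P)), restrict (\<lambda>x. x) (carrier G), (G, P)))"

definition canonical_epi :: "'u preord_grp \<Rightarrow> 'u preord_grp_arr" where
  "canonical_epi = (\<lambda>(G, P).
     let N = pos_neg (G, P); \<eta> = quotient_map G N
     in ((G, P), \<eta>, (quotient_group G N, \<eta> ` P)))"

definition torsion_theory_functor ::
  "('o, 'm) cat \<Rightarrow> 'o set \<Rightarrow> 'o set \<Rightarrow> ('u preord_grp \<Rightarrow> 'o) \<Rightarrow> ('u preord_grp_arr \<Rightarrow> 'm) \<Rightarrow> bool" where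
  "torsion_theory_functor S T F \<Phi>o \<Phi>a \<longleftrightarrow>
     pointed_category S \<and> torsion_theory S T F \<and> is_functor PreOrdGrp S \<Phi>o \<Phi>a \<and>
     (\<forall>X\<in>GrpPreOrdObj. \<Phi>o X \<in> T) \<and>
     (\<forall>X\<in>ParOrdGrpObj. \<Phi>o X \<in> F) \<and>
     (\<forall>X\<in>Obj PreOrdGrp. short_exact S (\<Phi>a (canonical_mono X)) (\<Phi>a (canonical_epi X)))"

section \<open>Adequacy of the encodings\<close>

lemma inj_on_coset_rep:
  assumes "group G" "subgroup N G"
  shows "inj_on coset_rep (carrier (G Mod N))"
proof (rule inj_onI)
  interpret group G by fact
  fix K L assume KL: "K \<in> carrier (G Mod N)" "L \<in> carrier (G Mod N)"
    and eq: "coset_rep K = coset_rep L"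
  have K: "K \<in> rcosets\<^bsub>G\<^esub> N" and L: "L \<in> rcosets\<^bsub>G\<^esub> N"
    using KL by (auto simp: FactGroup_def)
  have ne: "J \<noteq> {}" if "J \<in> rcosets\<^bsub>G\<^esub> N" for J
    using that rcos_self[OF _ assms(2)] by (fastforce simp: RCOSETS_def)
  have "coset_rep K \<in> K" "coset_rep L \<in> L"
    unfolding coset_rep_def using ne[OF K] ne[OF L] by (auto simp: some_in_eq)
  then show "K = L"
    using rcos_disjoint[OF assms(2)] K L eq by (auto simp: pairwise_def disjnt_def)
qed

lemma coset_rep_iso:
  assumes "group G" "N \<lhd> G"
  shows "coset_rep \<in> iso (G Mod N) (quotient_group G N)" and "group (quotient_group G N)"
proof -
  have inj: "inj_on coset_rep (carrier (G Mod N))"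
    by (rule inj_on_coset_rep[OF assms(1) normal_imp_subgroup[OF assms(2)]])
  show "coset_rep \<in> iso (G Mod N) (quotient_group G N)"
    unfolding quotient_group_def by (rule inj_imp_image_group_iso[OF inj])
  show "group (quotient_group G N)"
    unfolding quotient_group_def
    by (rule group.inj_imp_image_group_is_group[OF normal.factorgroup_is_group[OF assms(2)] inj])
qed

lemma embeddable_in_groupI:
  fixes M :: "'a monoid" and H :: "('b, 'c) monoid_scheme"
  assumes H: "group H" and f: "f \<in> mon M H"
  shows "embeddable_in_group M"
proof -
  interpret H: group H by fact
  define K where "K = generate H (f ` carrier M)"
  have f_hom: "f \<in> hom M H" and f_inj: "inj_on f (carrier M)" and f_sub: "f ` carrier M \<subseteq> carrier H"
    using f by (auto simp: mon_def hom_def)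
  define lt :: "bool \<times> 'a \<Rightarrow> 'b" where "lt = (\<lambda>(b, a). if b then f a else inv\<^bsub>H\<^esub> (f a))"
  define ev :: "(bool \<times> 'a) list \<Rightarrow> 'b" where "ev = (\<lambda>w. foldr (\<lambda>c y. lt c \<otimes>\<^bsub>H\<^esub> y) w \<one>\<^bsub>H\<^esub>)"
  define W :: "(bool \<times> 'a) list set" where "W = lists (UNIV \<times> carrier M)"
  have lt: "lt c \<in> carrier H" if "c \<in> UNIV \<times> carrier M" for c
    using that f_sub by (auto simp: lt_def)
  have ev_closed: "ev w \<in> carrier H" if "w \<in> W" for w
    using that unfolding W_def by (induction w) (auto simp: ev_def lt)
  have ev_append: "ev (v @ w) = ev v \<otimes>\<^bsub>H\<^esub> ev w" if "v \<in> W" "w \<in> W" for v w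
    using that(1) unfolding W_def
  proof (induction v)
    case Nil
    then show ?case using ev_closed[OF that(2)] by (simp add: ev_def)
  next
    case (Cons c v)
    then show ?case
      using ev_closed[of v] ev_closed[OF that(2)] lt by (simp add: ev_def W_def H.m_assoc)
  qed
  have word: "\<exists>w\<in>W. ev w = x" if "x \<in> K" for x
    using that unfolding K_def
  proof (induction rule: generate.induct)
    case one
    show ?case by (rule bexI[of _ "[]"]) (auto simp: ev_def W_def)
  next
    case (incl h)
    then obtain a where "a \<in> carrier M" "h = f a" by auto
    then show ?case
      using f_sub by (intro bexI[of _ "[(True, a)]"]) (auto simp: ev_def W_def lt_def)
  next
    case (inv h)
    then obtain a where "a \<in> carrier M" "h = f a" by auto
    then show ?case
      using f_sub by (intro bexI[of _ "[(False, a)]"]) (auto simp: ev_def W_def lt_def)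
  next
    case (eng h1 h2)
    then obtain v w where "v \<in> W" "w \<in> W" "ev v = h1" "ev w = h2" by auto
    then show ?case using ev_append by (intro bexI[of _ "v @ w"]) (auto simp: W_def)
  qed
  define s :: "'b \<Rightarrow> (bool \<times> 'a) list" where "s = (\<lambda>x. SOME w. ev w = x)"
  have "ev (s x) = x" if "x \<in> K" for x
    unfolding s_def using word[OF that] by (auto intro: someI)
  then have s_inj: "inj_on s (carrier (H\<lparr>carrier := K\<rparr>))"
    by (auto intro: inj_on_inverseI)
  have "subgroup K H"
    unfolding K_def using H.generate_is_subgroup[OF f_sub] .
  then have grp: "group (H\<lparr>carrier := K\<rparr>)"
    by (rule H.subgroup_imp_group)
  define L where "L = image_group s (H\<lparr>carrier := K\<rparr>)"
  have "group L"
    unfolding L_def by (rule group.inj_imp_image_group_is_group[OF grp s_inj])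
  moreover have "s \<circ> f \<in> mon M L"
  proof -
    have fK: "f ` carrier M \<subseteq> K"
      unfolding K_def by (auto intro: generate.incl)
    then have "f \<in> hom M (H\<lparr>carrier := K\<rparr>)"
      using f_hom by (auto simp: hom_def)
    moreover have "s \<in> hom (H\<lparr>carrier := K\<rparr>) L"
      unfolding L_def using inj_imp_image_group_iso[OF s_inj] by (simp add: iso_def)
    ultimately have "s \<circ> f \<in> hom M L"
      by (rule hom_compose)
    moreover have "inj_on (s \<circ> f) (carrier M)"
      using f_inj s_inj fK by (auto intro: comp_inj_on inj_on_subset)
    ultimately show ?thesis by (simp add: mon_def)
  qed
  ultimately show ?thesis
    unfolding embeddable_in_group_def by blast
qed

end

theory Submission
  imports Defs
begin

text \<open>
  The monoids in \<open>MonGe0\<close> are, up to isomorphism, exactly the positive cones of preordered groups: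
  if \<open>M\<close> embeds in \<open>H\<close>, then the condition \<open>a + b = b + x = y + a\<close> says that the image of \<open>M\<close> is
  stable under conjugation by the subgroup of \<open>H\<close> that it generates. A sequence \<open>K \<rightarrow> X \<rightarrow> Y\<close> is
  short exact in \<open>MonGe0\<close> as soon as the first map is injective with image the units of \<open>X\<close>, and
  the second is surjective and identifies exactly the elements that differ by a unit. The image
  under \<open>P\<close> of the canonical sequence of \<open>(G, P\<^sub>G)\<close> has this shape because \<open>N\<^sub>G\<close> is the group of
  units of \<open>P\<^sub>G\<close>; the torsion theory sequence of a monoid is obtained by presenting it as a
  positive cone.
\<close>

section \<open>Categories of structured sets\<close>

lemma concrete_cat_simps:
  "Obj (concrete_cat Ob U H) = Ob"
  "(A, f, B) \<in> Arr (concrete_cat Ob U H) \<longleftrightarrow>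
     A \<in> Ob \<and> B \<in> Ob \<and> f \<in> H A B \<and> f \<in> extensional (U A)"
  "Dom (concrete_cat Ob U H) (A, f, B) = A"
  "Cod (concrete_cat Ob U H) (A, f, B) = B"
  "Id (concrete_cat Ob U H) A = (A, restrict (\<lambda>x. x) (U A), A)"
  "Comp (concrete_cat Ob U H) (B', g, C) (A, f, B) = (A, compose (U A) g f, C)"
  by (auto simp: concrete_cat_def)

text \<open>The unit and associativity laws are equalities of total functions: on \<open>U A\<close>
  they follow once \<open>maps\<close> keeps values inside the next underlying set, and outside
  \<open>U A\<close> both sides are \<open>undefined\<close>.\<close>

lemma category_concrete_cat:
  assumes maps: "\<And>A B f x. A \<in> Ob \<Longrightarrow> B \<in> Ob \<Longrightarrow> f \<in> H A B \<Longrightarrow> x \<in> U A \<Longrightarrow> f x \<in> U B"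
    and ids: "\<And>A. A \<in> Ob \<Longrightarrow> restrict (\<lambda>x. x) (U A) \<in> H A A"
    and comps: "\<And>A B C f g. \<lbrakk>A \<in> Ob; B \<in> Ob; C \<in> Ob; f \<in> H A B; g \<in> H B C\<rbrakk>
      \<Longrightarrow> compose (U A) g f \<in> H A C"
  shows "category (concrete_cat Ob U H)"
  unfolding category_def Hom_def
proof (intro conjI ballI impI)
  let ?C = "concrete_cat Ob U H"
  fix f assume "f \<in> Arr ?C"
  then obtain A f' B where f: "f = (A, f', B)" "A \<in> Ob" "B \<in> Ob" "f' \<in> H A B" "f' \<in> extensional (U A)"
    by (cases f) (auto simp: concrete_cat_simps)
  show "Dom ?C f \<in> Obj ?C" "Cod ?C f \<in> Obj ?C"
    using f by (auto simp: concrete_cat_simps)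
  show "Comp ?C f (Id ?C (Dom ?C f)) = f" "Comp ?C (Id ?C (Cod ?C f)) f = f"
    using f maps by (auto simp: concrete_cat_simps compose_def fun_eq_iff extensional_def)
  fix g assume "g \<in> Arr ?C"
  then obtain B' g' C where g: "g = (B', g', C)" "B' \<in> Ob" "C \<in> Ob" "g' \<in> H B' C"
    by (cases g) (auto simp: concrete_cat_simps)
  { assume "Cod ?C f = Dom ?C g"
    with f g show "Comp ?C g f \<in> {h \<in> Arr ?C. Dom ?C h = Dom ?C f \<and> Cod ?C h = Cod ?C g}"
      using comps by (auto simp: concrete_cat_simps) }
  fix h assume "h \<in> Arr ?C" and eq: "Cod ?C f = Dom ?C g" "Cod ?C g = Dom ?C h"
  then obtain C' h' D where h: "h = (C', h', D)"
    by (cases h) auto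
  show "Comp ?C h (Comp ?C g f) = Comp ?C (Comp ?C h g) f"
    using f g h eq maps by (auto simp: concrete_cat_simps compose_def fun_eq_iff)
next
  let ?C = "concrete_cat Ob U H"
  fix A assume "A \<in> Obj ?C"
  then show "Id ?C A \<in> {f \<in> Arr ?C. Dom ?C f = A \<and> Cod ?C f = A}"
    using ids by (auto simp: concrete_cat_simps)
qed

lemma full_subcategory_simps [simp]:
  "Obj (full_subcategory C S) = Obj C \<inter> S"
  "Arr (full_subcategory C S) = {f \<in> Arr C. Dom C f \<in> S \<and> Cod C f \<in> S}"
  "Dom (full_subcategory C S) = Dom C"
  "Cod (full_subcategory C S) = Cod C"
  "Id (full_subcategory C S) = Id C"
  "Comp (full_subcategory C S) = Comp C"
  by (simp_all add: full_subcategory_def)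

lemma category_full_subcategory: "category C \<Longrightarrow> category (full_subcategory C S)"
  unfolding category_def Hom_def by auto

section \<open>Monoids that are positive cones\<close>

text \<open>This is the object predicate of \<open>MonGe0\<close> with the nested full subcategories
  unfolded, see \<open>MonGe0_simps\<close>.\<close>

definition mon_ge0 :: "'a monoid \<Rightarrow> bool" where
  "mon_ge0 M \<longleftrightarrow> monoid M \<and> embeddable_in_group M \<and>
     (\<forall>a\<in>carrier M. \<forall>b\<in>carrier M. \<exists>x\<in>carrier M. \<exists>y\<in>carrier M.
        a \<otimes>\<^bsub>M\<^esub> b = b \<otimes>\<^bsub>M\<^esub> x \<and> a \<otimes>\<^bsub>M\<^esub> b = y \<otimes>\<^bsub>M\<^esub> a)"

lemma mon_ge0_imp_monoid: "mon_ge0 M \<Longrightarrow> monoid M"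
  by (simp add: mon_ge0_def)

section \<open>Monoid homomorphisms and transport along isomorphisms\<close>

lemma monoid_homsD:
  assumes "f \<in> monoid_homs M N"
  shows "x \<in> carrier M \<Longrightarrow> f x \<in> carrier N"
    and "x \<in> carrier M \<Longrightarrow> y \<in> carrier M \<Longrightarrow> f (x \<otimes>\<^bsub>M\<^esub> y) = f x \<otimes>\<^bsub>N\<^esub> f y"
    and "f \<one>\<^bsub>M\<^esub> = \<one>\<^bsub>N\<^esub>"
  using assms by (auto simp: monoid_homs_def hom_def)

lemma monoid_homsI:
  assumes "\<And>x. x \<in> carrier M \<Longrightarrow> f x \<in> carrier N"
    and "\<And>x y. x \<in> carrier M \<Longrightarrow> y \<in> carrier M \<Longrightarrow> f (x \<otimes>\<^bsub>M\<^esub> y) = f x \<otimes>\<^bsub>N\<^esub> f y"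
    and "f \<one>\<^bsub>M\<^esub> = \<one>\<^bsub>N\<^esub>"
  shows "f \<in> monoid_homs M N"
  using assms by (auto simp: monoid_homs_def hom_def)

lemma restrict_monoid_homs:
  assumes "monoid M" "f \<in> monoid_homs M N"
  shows "restrict f (carrier M) \<in> monoid_homs M N"
proof -
  interpret monoid M by fact
  show ?thesis using assms(2) by (auto simp: monoid_homs_def hom_def)
qed

lemma compose_monoid_homs:
  assumes "monoid M" "f \<in> monoid_homs M N" "g \<in> monoid_homs N K"
  shows "compose (carrier M) g f \<in> monoid_homs M K"
proof -
  interpret monoid M by fact
  show ?thesis using assms(2,3) by (auto simp: monoid_homs_def hom_def compose_def Pi_def)
qed

lemma monoid_homs_Units:
  assumes "monoid M" "f \<in> monoid_homs M N" "x \<in> Units M"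
  shows "f x \<in> Units N"
proof -
  interpret monoid M by fact
  obtain y where "y \<in> carrier M" "y \<otimes>\<^bsub>M\<^esub> x = \<one>\<^bsub>M\<^esub>" "x \<otimes>\<^bsub>M\<^esub> y = \<one>\<^bsub>M\<^esub>"
    using assms(3) by (auto simp: Units_def)
  then have "f y \<in> carrier N" "f y \<otimes>\<^bsub>N\<^esub> f x = \<one>\<^bsub>N\<^esub>" "f x \<otimes>\<^bsub>N\<^esub> f y = \<one>\<^bsub>N\<^esub>"
    using monoid_homsD[OF assms(2)] Units_closed[OF assms(3)] by metis+
  then show ?thesis
    using monoid_homsD(1)[OF assms(2)] assms(3) by (auto simp: Units_def)
qed

text \<open>Elements of \<open>iso\<close> are only required to be multiplicative. By surjectivity
  some \<open>u\<close> is sent to the unit of \<open>N\<close>; multiplying \<open>u\<close> by the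
  unit of \<open>M\<close> and applying \<open>e\<close> shows that \<open>e\<close> preserves the
  unit.\<close>

lemma iso_imp_monoid_homs:
  assumes "monoid M" "monoid N" "e \<in> iso M N"
  shows "e \<in> monoid_homs M N"
proof -
  interpret M: monoid M by fact
  interpret N: monoid N by fact
  have e: "e \<in> hom M N" and surj: "e ` carrier M = carrier N"
    using assms(3) by (auto simp: iso_def bij_betw_def)
  obtain u where u: "u \<in> carrier M" "e u = \<one>\<^bsub>N\<^esub>"
    using surj N.one_closed by (metis imageE)
  have "e \<one>\<^bsub>M\<^esub> \<otimes>\<^bsub>N\<^esub> e u = e u"
    using hom_mult[OF e M.one_closed u(1)] u(1) by simp
  then have "e \<one>\<^bsub>M\<^esub> = \<one>\<^bsub>N\<^esub>"
    using u hom_in_carrier[OF e M.one_closed] by simp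
  then show ?thesis
    using e by (simp add: monoid_homs_def)
qed

lemma iso_inv_into:
  assumes "monoid M" "e \<in> iso M N"
  shows "inv_into (carrier M) e \<in> iso N M"
proof -
  interpret monoid M by fact
  let ?e' = "inv_into (carrier M) e"
  have e: "e \<in> hom M N" "inj_on e (carrier M)" and img: "e ` carrier M = carrier N"
    using assms(2) by (auto simp: iso_def bij_betw_def)
  have bij: "bij_betw ?e' (carrier N) (carrier M)"
    using assms(2) by (auto simp: iso_def intro: bij_betw_inv_into)
  have "?e' (x \<otimes>\<^bsub>N\<^esub> y) = ?e' x \<otimes>\<^bsub>M\<^esub> ?e' y" if "x \<in> carrier N" "y \<in> carrier N" for x y
  proof -
    have x: "?e' x \<in> carrier M" "e (?e' x) = x" and y: "?e' y \<in> carrier M" "e (?e' y) = y"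
      using that img by (auto simp: inv_into_into f_inv_into_f)
    then have "x \<otimes>\<^bsub>N\<^esub> y = e (?e' x \<otimes>\<^bsub>M\<^esub> ?e' y)"
      using hom_mult[OF e(1)] by metis
    then show ?thesis
      using inv_into_f_f[OF e(2)] x(1) y(1) by simp
  qed
  then show ?thesis
    using bij by (auto simp: iso_def hom_def bij_betw_def)
qed

text \<open>An embedding of \<open>N\<close> is the inverse of \<open>e\<close> followed by one of
  \<open>M\<close>. Since \<open>N\<close> may live over another type,
  \<open>embeddable_in_groupI\<close> renames the ambient group. This lets a quotient built over
  words be carried back to the original universe.\<close>

lemma mon_ge0_iso:
  fixes M :: "'a monoid"
  assumes M: "mon_ge0 M" and e: "e \<in> iso M N" and N: "monoid N"
  shows "mon_ge0 N"
proof -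
  have e': "inv_into (carrier M) e \<in> iso N M"
    by (rule iso_inv_into[OF mon_ge0_imp_monoid[OF M] e])
  have e_hom: "e \<in> hom M N"
    using e by (simp add: iso_def)
  have e_img: "e ` carrier M = carrier N"
    using e by (simp add: iso_def bij_betw_def)
  note e_mult = hom_mult[OF e_hom]
  obtain H :: "(bool \<times> 'a) list monoid" and f where H: "group H" and f: "f \<in> mon M H"
    using M by (auto simp: mon_ge0_def embeddable_in_group_def)
  have "inv_into (carrier M) e \<in> mon N M"
    using e' by (simp add: iso_iff_mon_epi)
  then have "embeddable_in_group N"
    by (rule embeddable_in_groupI[OF H mon_compose[OF _ f]])
  moreover have "\<exists>x\<in>carrier N. \<exists>y\<in>carrier N. a \<otimes>\<^bsub>N\<^esub> b = b \<otimes>\<^bsub>N\<^esub> x \<and> a \<otimes>\<^bsub>N\<^esub> b = y \<otimes>\<^bsub>N\<^esub> a"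
    if ab_N: "a \<in> carrier N" "b \<in> carrier N" for a b
  proof -
    obtain a' b' where ab: "a' \<in> carrier M" "b' \<in> carrier M" "a = e a'" "b = e b'"
      using ab_N e_img by (metis imageE)
    then obtain x y where "x \<in> carrier M" "y \<in> carrier M"
      "a' \<otimes>\<^bsub>M\<^esub> b' = b' \<otimes>\<^bsub>M\<^esub> x" "a' \<otimes>\<^bsub>M\<^esub> b' = y \<otimes>\<^bsub>M\<^esub> a'"
      using M unfolding mon_ge0_def by meson
    then have "a \<otimes>\<^bsub>N\<^esub> b = b \<otimes>\<^bsub>N\<^esub> e x" "a \<otimes>\<^bsub>N\<^esub> b = e y \<otimes>\<^bsub>N\<^esub> a" "e x \<in> carrier N" "e y \<in> carrier N"
      using ab e_mult hom_in_carrier[OF e_hom] by metis+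
    then show ?thesis by blast
  qed
  ultimately show ?thesis
    using N by (auto simp: mon_ge0_def)
qed

section \<open>Positive cones of preordered groups\<close>

lemma pos_cone_simps [simp]:
  "carrier (pos_cone (G, P)) = P"
  "mult (pos_cone (G, P)) = mult G"
  "one (pos_cone (G, P)) = one G"
  by (simp_all add: pos_cone_def)

text \<open>\<open>G\<close> itself is the ambient group. The required solutions are conjugates:
  \<open>x\<close> is \<open>a\<close> conjugated by the inverse of \<open>b\<close>, and
  \<open>y\<close> is \<open>b\<close> conjugated by \<open>a\<close>.\<close>

lemma mon_ge0_pos_cone:
  assumes "preordered_group X"
  shows "mon_ge0 (pos_cone X)"
proof -
  obtain G P where X: "X = (G, P)" by (cases X)
  have G: "group G" and P: "submonoid P G"
    and conj: "\<And>g p. g \<in> carrier G \<Longrightarrow> p \<in> P \<Longrightarrow> g \<otimes>\<^bsub>G\<^esub> p \<otimes>\<^bsub>G\<^esub> inv\<^bsub>G\<^esub> g \<in> P"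
    using assms by (auto simp: X preordered_group_def)
  interpret G: group G by fact
  interpret P: submonoid P G by fact
  have "monoid (pos_cone X)"
    unfolding X pos_cone_def by (simp add: P.submonoid_is_monoid G.monoid_axioms)
  moreover have "(\<lambda>x. x) \<in> mon (pos_cone X) G"
    by (auto simp: X mon_def hom_def)
  then have "embeddable_in_group (pos_cone X)"
    by (rule embeddable_in_groupI[OF G])
  moreover have "\<exists>x\<in>P. \<exists>y\<in>P. a \<otimes>\<^bsub>G\<^esub> b = b \<otimes>\<^bsub>G\<^esub> x \<and> a \<otimes>\<^bsub>G\<^esub> b = y \<otimes>\<^bsub>G\<^esub> a"
    if ab: "a \<in> P" "b \<in> P" for a b
  proof -
    have "a \<otimes>\<^bsub>G\<^esub> b = b \<otimes>\<^bsub>G\<^esub> (inv\<^bsub>G\<^esub> b \<otimes>\<^bsub>G\<^esub> a \<otimes>\<^bsub>G\<^esub> b)" "inv\<^bsub>G\<^esub> b \<otimes>\<^bsub>G\<^esub> a \<otimes>\<^bsub>G\<^esub> b \<in> P"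
      using ab conj[of "inv\<^bsub>G\<^esub> b" a] by (simp_all add: G.m_assoc[symmetric])
    moreover have "a \<otimes>\<^bsub>G\<^esub> b = a \<otimes>\<^bsub>G\<^esub> b \<otimes>\<^bsub>G\<^esub> inv\<^bsub>G\<^esub> a \<otimes>\<^bsub>G\<^esub> a" "a \<otimes>\<^bsub>G\<^esub> b \<otimes>\<^bsub>G\<^esub> inv\<^bsub>G\<^esub> a \<in> P"
      using ab conj by (simp_all add: G.m_assoc)
    ultimately show ?thesis by blast
  qed
  ultimately show ?thesis
    by (simp add: mon_ge0_def X)
qed

text \<open>Every group is the positive cone of the preordered group in which all elements are
  positive.\<close>

lemma group_imp_mon_ge0:
  assumes "group M"
  shows "mon_ge0 M"
proof -
  interpret group M by fact
  have "preordered_group (M, carrier M)"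
    by (auto simp: preordered_group_def submonoid_def)
  from mon_ge0_pos_cone[OF this] show ?thesis
    by (simp add: pos_cone_def)
qed

text \<open>Conjugation by a product is the composite of the conjugations, so induction on generated
  elements reduces to single generators. These may also occur inverted, hence both
  \<open>pos\<close> and \<open>neg\<close>.\<close>

lemma (in group) generate_conj_closed:
  assumes P: "P \<subseteq> carrier G"
    and pos: "\<And>a p. a \<in> P \<Longrightarrow> p \<in> P \<Longrightarrow> a \<otimes> p \<otimes> inv a \<in> P"
    and neg: "\<And>a p. a \<in> P \<Longrightarrow> p \<in> P \<Longrightarrow> inv a \<otimes> p \<otimes> a \<in> P"
    and "g \<in> generate G P" "p \<in> P"
  shows "g \<otimes> p \<otimes> inv g \<in> P"
  using assms(4,5)
proof (induction arbitrary: p rule: generate.induct)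
  case one
  then show ?case using P by auto
next
  case (incl h)
  then show ?case using pos by auto
next
  case (inv h)
  then show ?case using neg P by auto
next
  case (eng g h)
  then have "g \<in> carrier G" "h \<in> carrier G" "p \<in> carrier G"
    using P generate_in_carrier by auto
  then have "g \<otimes> h \<otimes> p \<otimes> inv (g \<otimes> h) = g \<otimes> (h \<otimes> p \<otimes> inv h) \<otimes> inv g"
    by (simp add: m_assoc inv_mult_group)
  then show ?case using eng by simp
qed

text \<open>The swapping condition controls conjugation only by elements generated by the image of
  \<open>M\<close>, so \<open>H\<close> is cut down to that subgroup. The cone lives over signed
  words because \<open>embeddable_in_group\<close> provides \<open>H\<close> there.\<close>

lemma mon_ge0_iso_pos_cone:
  fixes M :: "'a monoid"
  assumes "mon_ge0 M"
  obtains X :: "(bool \<times> 'a) list preord_grp" and e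
    where "preordered_group X" "e \<in> iso M (pos_cone X)"
proof -
  interpret M: monoid M using assms by (rule mon_ge0_imp_monoid)
  obtain H :: "(bool \<times> 'a) list monoid" and f where H: "group H" and f: "f \<in> mon M H"
    using assms by (auto simp: mon_ge0_def embeddable_in_group_def)
  interpret H: group H by fact
  have f_hom: "f \<in> hom M H" and f_inj: "inj_on f (carrier M)"
    using f by (auto simp: mon_def)
  note f_mult = hom_mult[OF f_hom]
  have f_closed: "\<And>x. x \<in> carrier M \<Longrightarrow> f x \<in> carrier H"
    using f_hom by (auto simp: hom_def)
  \<comment> \<open>Members of \<open>mon\<close> need not preserve the unit by definition; here
    \<open>f\<close> of the unit is idempotent in a group, hence trivial.\<close>
  have f_one: "f \<one>\<^bsub>M\<^esub> = \<one>\<^bsub>H\<^esub>"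
    using f_mult[of "\<one>\<^bsub>M\<^esub>" "\<one>\<^bsub>M\<^esub>"] f_closed[of "\<one>\<^bsub>M\<^esub>"] by (simp add: H.r_cancel_one)
  define P where "P = f ` carrier M"
  define K where "K = generate H P"
  define G where "G = H\<lparr>carrier := K\<rparr>"
  have PH: "P \<subseteq> carrier H" using f_closed by (auto simp: P_def)
  have K: "subgroup K H" unfolding K_def by (rule H.generate_is_subgroup[OF PH])
  have PK: "P \<subseteq> K" by (auto simp: K_def intro: generate.incl)
  have swap: "\<exists>x\<in>carrier M. \<exists>y\<in>carrier M. a \<otimes>\<^bsub>M\<^esub> b = b \<otimes>\<^bsub>M\<^esub> x \<and> a \<otimes>\<^bsub>M\<^esub> b = y \<otimes>\<^bsub>M\<^esub> a"
    if "a \<in> carrier M" "b \<in> carrier M" for a b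
    using assms that by (auto simp: mon_ge0_def)
  have pos: "a \<otimes>\<^bsub>H\<^esub> p \<otimes>\<^bsub>H\<^esub> inv\<^bsub>H\<^esub> a \<in> P" if aP: "a \<in> P" "p \<in> P" for a p
  proof -
    obtain a' p' where ap: "a' \<in> carrier M" "p' \<in> carrier M" "a = f a'" "p = f p'"
      using aP by (auto simp: P_def)
    \<comment> \<open>In additive notation, \<open>a' + p' = y + a'\<close> identifies the conjugate
      of \<open>p\<close> by \<open>a\<close> with \<open>f y\<close>.\<close>
    obtain y where y: "y \<in> carrier M" "a' \<otimes>\<^bsub>M\<^esub> p' = y \<otimes>\<^bsub>M\<^esub> a'"
      using swap ap by blast
    then have "a \<otimes>\<^bsub>H\<^esub> p = f y \<otimes>\<^bsub>H\<^esub> a"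
      using ap f_mult by metis
    then have "a \<otimes>\<^bsub>H\<^esub> p \<otimes>\<^bsub>H\<^esub> inv\<^bsub>H\<^esub> a = f y"
      using ap y f_closed by (simp add: H.m_assoc)
    then show ?thesis using y by (simp add: P_def)
  qed
  have neg: "inv\<^bsub>H\<^esub> a \<otimes>\<^bsub>H\<^esub> p \<otimes>\<^bsub>H\<^esub> a \<in> P" if aP: "a \<in> P" "p \<in> P" for a p
  proof -
    obtain a' p' where ap: "a' \<in> carrier M" "p' \<in> carrier M" "a = f a'" "p = f p'"
      using aP by (auto simp: P_def)
    \<comment> \<open>Here \<open>swap\<close> is applied to \<open>p'\<close> and \<open>a'\<close>
      in this order: its \<open>x\<close> solves \<open>p' + a' = a' + x\<close>, so
      \<open>f x\<close> is the conjugate of \<open>p\<close> by the inverse of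
      \<open>a\<close>.\<close>
    obtain x where x: "x \<in> carrier M" "p' \<otimes>\<^bsub>M\<^esub> a' = a' \<otimes>\<^bsub>M\<^esub> x"
      using swap ap by blast
    then have "p \<otimes>\<^bsub>H\<^esub> a = a \<otimes>\<^bsub>H\<^esub> f x"
      using ap f_mult by metis
    then have "inv\<^bsub>H\<^esub> a \<otimes>\<^bsub>H\<^esub> p \<otimes>\<^bsub>H\<^esub> a = f x"
      using ap x f_closed by (simp add: H.m_assoc H.inv_solve_left')
    then show ?thesis using x by (simp add: P_def)
  qed
  have "\<one>\<^bsub>H\<^esub> \<in> P"
    unfolding P_def using f_one M.one_closed by (metis imageI)
  moreover have "x \<otimes>\<^bsub>H\<^esub> y \<in> P" if "x \<in> P" "y \<in> P" for x y
    using that unfolding P_def by (auto simp: f_mult[symmetric])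
  ultimately have "preordered_group (G, P)"
    using H.subgroup_imp_group[OF K] PK H.generate_conj_closed[OF PH pos neg]
    by (auto simp: preordered_group_def submonoid_def G_def K K_def[symmetric])
  moreover have "f \<in> iso M (pos_cone (G, P))"
    using f_inj f_mult by (auto simp: iso_def hom_def bij_betw_def G_def P_def)
  ultimately show ?thesis by (rule that)
qed

section \<open>Quotients of preordered groups\<close>

text \<open>By \<open>inj_on_coset_rep\<close>, passing to representatives identifies no two cosets,
  so only equality of cosets is at stake.\<close>

lemma quotient_map_eq_iff:
  assumes "group G" "subgroup N G" "x \<in> carrier G" "y \<in> carrier G"
  shows "quotient_map G N x = quotient_map G N y \<longleftrightarrow> x \<in> N #>\<^bsub>G\<^esub> y"
proof -
  interpret group G by fact
  have "N #>\<^bsub>G\<^esub> x \<in> carrier (G Mod N)" "N #>\<^bsub>G\<^esub> y \<in> carrier (G Mod N)"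
    using assms by (auto simp: FactGroup_def RCOSETS_def)
  then have "quotient_map G N x = quotient_map G N y \<longleftrightarrow> N #>\<^bsub>G\<^esub> x = N #>\<^bsub>G\<^esub> y"
    using inj_onD[OF inj_on_coset_rep[OF assms(1,2)]] assms(3,4) by (auto simp: quotient_map_def)
  also have "\<dots> \<longleftrightarrow> x \<in> N #>\<^bsub>G\<^esub> y"
    using assms repr_independence rcos_self by metis
  finally show ?thesis .
qed

lemma quotient_map_hom:
  assumes "group G" "N \<lhd> G"
  shows "quotient_map G N \<in> hom G (quotient_group G N)"
proof -
  interpret normal N G by fact
  have "coset_rep \<circ> (\<lambda>x. N #>\<^bsub>G\<^esub> x) \<in> hom G (quotient_group G N)"
    using coset_rep_iso(1)[OF assms] by (intro Group.hom_compose[OF r_coset_hom_Mod]) (simp add: iso_def)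
  then show ?thesis
    by (rule hom_restrict) (simp add: quotient_map_def)
qed

lemma quotient_map_surj: "quotient_map G N ` carrier G = carrier (quotient_group G N)"
  by (auto simp: quotient_group_def image_group_carrier quotient_map_def FactGroup_def RCOSETS_def)

text \<open>The image of the cone is stable under conjugation by elements in the image of
  \<open>f\<close>; surjectivity makes these all of \<open>H\<close>.\<close>

lemma preordered_group_image:
  assumes X: "preordered_group (G, P)" and H: "group H" and f: "f \<in> hom G H"
    and surj: "f ` carrier G = carrier H"
  shows "preordered_group (H, f ` P)"
proof -
  have G: "group G" and P: "submonoid P G"
    and conj: "\<And>g p. g \<in> carrier G \<Longrightarrow> p \<in> P \<Longrightarrow> g \<otimes>\<^bsub>G\<^esub> p \<otimes>\<^bsub>G\<^esub> inv\<^bsub>G\<^esub> g \<in> P"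
    using X by (auto simp: preordered_group_def)
  interpret group_hom G H f
    using G H f by (simp add: group_hom_def group_hom_axioms_def)
  interpret P: submonoid P G by fact
  have "h \<otimes>\<^bsub>H\<^esub> q \<otimes>\<^bsub>H\<^esub> inv\<^bsub>H\<^esub> h \<in> f ` P" if hq: "h \<in> carrier H" "q \<in> f ` P" for h q
  proof -
    have "h \<in> f ` carrier G" using hq surj by simp
    with hq obtain g p where gp: "g \<in> carrier G" "p \<in> P" "h = f g" "q = f p"
      by blast
    then have "f (g \<otimes>\<^bsub>G\<^esub> p \<otimes>\<^bsub>G\<^esub> inv\<^bsub>G\<^esub> g) = h \<otimes>\<^bsub>H\<^esub> q \<otimes>\<^bsub>H\<^esub> inv\<^bsub>H\<^esub> h"
      by simp
    then show ?thesis
      using conj gp by (metis imageI)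
  qed
  moreover have "submonoid (f ` P) H"
  proof
    show "f ` P \<subseteq> carrier H" by auto
    show "\<one>\<^bsub>H\<^esub> \<in> f ` P" using hom_one P.one_closed by (metis imageI)
    fix x y assume "x \<in> f ` P" "y \<in> f ` P"
    then obtain a b where "a \<in> P" "b \<in> P" "x = f a" "y = f b" by auto
    then have "x \<otimes>\<^bsub>H\<^esub> y = f (a \<otimes>\<^bsub>G\<^esub> b)" "a \<otimes>\<^bsub>G\<^esub> b \<in> P" by auto
    then show "x \<otimes>\<^bsub>H\<^esub> y \<in> f ` P" by simp
  qed
  ultimately show ?thesis
    using H by (auto simp: preordered_group_def)
qed

section \<open>The units of a cone and the canonical quotient\<close>

context
  fixes G :: "'a monoid" and P :: "'a set"
  assumes preordered: "preordered_group (G, P)"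
begin

interpretation G: group G
  using preordered by (simp add: preordered_group_def)

interpretation P: submonoid P G
  using preordered by (simp add: preordered_group_def)

lemma pos_cone_conj_closed: "g \<in> carrier G \<Longrightarrow> p \<in> P \<Longrightarrow> g \<otimes>\<^bsub>G\<^esub> p \<otimes>\<^bsub>G\<^esub> inv\<^bsub>G\<^esub> g \<in> P"
  using preordered by (simp add: preordered_group_def)

text \<open>An inverse taken inside the cone is also an inverse in \<open>G\<close>, so by
  uniqueness it is the group inverse. Thus the subgroup \<open>pos_neg\<close> is determined by the
  cone as a monoid.\<close>

lemma Units_pos_cone: "Units (pos_cone (G, P)) = pos_neg (G, P)"
proof (intro equalityI subsetI)
  fix x assume "x \<in> Units (pos_cone (G, P))"
  then obtain y where "x \<in> P" "y \<in> P" "y \<otimes>\<^bsub>G\<^esub> x = \<one>\<^bsub>G\<^esub>"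
    by (auto simp: Units_def)
  then show "x \<in> pos_neg (G, P)"
    using G.inv_equality[of y x] by (auto simp: pos_neg_def)
next
  fix x assume "x \<in> pos_neg (G, P)"
  then show "x \<in> Units (pos_cone (G, P))"
    by (auto simp: pos_neg_def Units_def intro!: bexI[of _ "inv\<^bsub>G\<^esub> x"])
qed

lemma pos_neg_subset: "pos_neg (G, P) \<subseteq> P"
  by (auto simp: pos_neg_def)

text \<open>The inverse of a conjugate is the conjugate of the inverse, so both membership
  conditions in \<open>pos_neg\<close> inherit stability from \<open>P\<close>.\<close>

lemma normal_pos_neg: "pos_neg (G, P) \<lhd> G"
  unfolding G.normal_inv_iff
proof (intro conjI ballI)
  show "subgroup (pos_neg (G, P)) G"
    by (rule G.subgroupI) (auto simp: pos_neg_def G.inv_mult_group intro: exI[of _ "\<one>\<^bsub>G\<^esub>"])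
  fix x h assume xh: "x \<in> carrier G" "h \<in> pos_neg (G, P)"
  then have "inv\<^bsub>G\<^esub> (x \<otimes>\<^bsub>G\<^esub> h \<otimes>\<^bsub>G\<^esub> inv\<^bsub>G\<^esub> x) = x \<otimes>\<^bsub>G\<^esub> inv\<^bsub>G\<^esub> h \<otimes>\<^bsub>G\<^esub> inv\<^bsub>G\<^esub> x"
    by (simp add: pos_neg_def G.inv_mult_group G.m_assoc)
  then show "x \<otimes>\<^bsub>G\<^esub> h \<otimes>\<^bsub>G\<^esub> inv\<^bsub>G\<^esub> x \<in> pos_neg (G, P)"
    using xh pos_cone_conj_closed by (simp add: pos_neg_def)
qed

lemma preordered_group_pos_neg: "preordered_group (G, pos_neg (G, P))"
  using normal_pos_neg
  by (auto simp: preordered_group_def G.normal_inv_iff subgroup_is_submonoid)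

abbreviation "canonical_quotient \<equiv> quotient_map G (pos_neg (G, P))"

lemma preordered_group_quotient:
  "preordered_group (quotient_group G (pos_neg (G, P)), canonical_quotient ` P)"
  using preordered_group_image[OF preordered coset_rep_iso(2) quotient_map_hom quotient_map_surj]
    G.group_axioms normal_pos_neg by blast

lemma canonical_quotient_monoid_homs:
  "canonical_quotient \<in> monoid_homs (pos_cone (G, P))
     (pos_cone (quotient_group G (pos_neg (G, P)), canonical_quotient ` P))"
proof -
  have hom: "canonical_quotient \<in> hom G (quotient_group G (pos_neg (G, P)))"
    by (rule quotient_map_hom[OF G.group_axioms normal_pos_neg])
  then have "canonical_quotient \<one>\<^bsub>G\<^esub> = \<one>\<^bsub>quotient_group G (pos_neg (G, P))\<^esub>"
    by (rule hom_one) (simp_all add: G.group_axioms coset_rep_iso(2)[OF _ normal_pos_neg])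
  then show ?thesis
    using hom by (auto simp: hom_def intro!: monoid_homsI)
qed

text \<open>The fibres are expressed through units of the cone, so that the statement transports
  along monoid isomorphisms and matches the hypothesis \<open>q_eq\<close> of
  \<open>short_exact_MonGe0I\<close>.\<close>

lemma canonical_quotient_eq_iff:
  assumes "x \<in> P" "y \<in> P"
  shows "canonical_quotient x = canonical_quotient y
    \<longleftrightarrow> (\<exists>n\<in>Units (pos_cone (G, P)). x = n \<otimes>\<^bsub>G\<^esub> y)"
  using quotient_map_eq_iff[OF G.group_axioms normal_imp_subgroup[OF normal_pos_neg], of x y] assms
  by (auto simp: Units_pos_cone r_coset_def)

end

text \<open>\<open>M\<close> is presented as a positive cone and divided by its units via the
  canonical quotient. The result lives over signed words, so it is copied back to \<open>'u\<close>
  by choosing a preimage in \<open>M\<close> for every element.\<close>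

lemma mon_ge0_quotient_Units:
  fixes M :: "'u monoid"
  assumes "mon_ge0 M"
  obtains Y :: "'u monoid" and q where "mon_ge0 Y" "q \<in> monoid_homs M Y"
    "q ` carrier M = carrier Y"
    "\<And>x y. x \<in> carrier M \<Longrightarrow> y \<in> carrier M \<Longrightarrow> q x = q y \<longleftrightarrow> (\<exists>n\<in>Units M. x = n \<otimes>\<^bsub>M\<^esub> y)"
proof -
  obtain X :: "(bool \<times> 'u) list preord_grp" and e
    where X: "preordered_group X" and e: "e \<in> iso M (pos_cone X)"
    using mon_ge0_iso_pos_cone[OF assms] .
  obtain G P where GP: "X = (G, P)" by (cases X)
  note X = X[unfolded GP] and e = e[unfolded GP]
  let ?\<eta> = "quotient_map G (pos_neg (G, P))"
  define Q where "Q = pos_cone (quotient_group G (pos_neg (G, P)), ?\<eta> ` P)"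
  interpret M: monoid M using assms by (rule mon_ge0_imp_monoid)
  have Q: "mon_ge0 Q"
    unfolding Q_def by (rule mon_ge0_pos_cone[OF preordered_group_quotient[OF X]])
  have Pm: "monoid (pos_cone (G, P))"
    by (rule mon_ge0_imp_monoid[OF mon_ge0_pos_cone[OF X]])
  have e_hom: "e \<in> monoid_homs M (pos_cone (G, P))"
    by (rule iso_imp_monoid_homs[OF M.monoid_axioms Pm e])
  have e_img: "e ` carrier M = P" and e_inj: "inj_on e (carrier M)"
    using e by (auto simp: iso_def bij_betw_def)
  define g where "g = compose (carrier M) ?\<eta> e"
  have g: "g \<in> monoid_homs M Q"
    unfolding g_def Q_def
    by (rule compose_monoid_homs[OF M.monoid_axioms e_hom canonical_quotient_monoid_homs[OF X]])
  have g_img: "g ` carrier M = carrier Q"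
    using e_img by (auto simp: g_def compose_def Q_def)
  \<comment> \<open>An isomorphism and its inverse both preserve units; this translates fibres
    described by units of the cone into fibres described by units of \<open>M\<close>.\<close>
  have e_units: "e ` Units M = Units (pos_cone (G, P))"
  proof (intro equalityI subsetI)
    fix x assume "x \<in> e ` Units M"
    then show "x \<in> Units (pos_cone (G, P))"
      using monoid_homs_Units[OF M.monoid_axioms e_hom] by auto
  next
    fix x assume x: "x \<in> Units (pos_cone (G, P))"
    have "inv_into (carrier M) e \<in> iso (pos_cone (G, P)) M"
      by (rule iso_inv_into[OF M.monoid_axioms e])
    then have "inv_into (carrier M) e \<in> monoid_homs (pos_cone (G, P)) M"
      by (rule iso_imp_monoid_homs[OF Pm M.monoid_axioms])
    then have "inv_into (carrier M) e x \<in> Units M"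
      by (rule monoid_homs_Units[OF Pm _ x])
    moreover have "x = e (inv_into (carrier M) e x)"
      using x e_img by (auto simp: f_inv_into_f Units_def)
    ultimately show "x \<in> e ` Units M" by blast
  qed
  have g_eq: "g x = g y \<longleftrightarrow> (\<exists>n\<in>Units M. x = n \<otimes>\<^bsub>M\<^esub> y)"
    if "x \<in> carrier M" "y \<in> carrier M" for x y
  proof -
    have "g x = g y \<longleftrightarrow> (\<exists>n\<in>Units (pos_cone (G, P)). e x = n \<otimes>\<^bsub>G\<^esub> e y)"
      using canonical_quotient_eq_iff[OF X, of "e x" "e y"] that e_img by (auto simp: g_def compose_def)
    also have "\<dots> \<longleftrightarrow> (\<exists>n\<in>Units M. e x = e n \<otimes>\<^bsub>G\<^esub> e y)"
      unfolding e_units[symmetric] by blast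
    also have "\<dots> \<longleftrightarrow> (\<exists>n\<in>Units M. e x = e (n \<otimes>\<^bsub>M\<^esub> y))"
      using monoid_homsD(2)[OF e_hom _ that(2)] M.Units_closed by auto
    also have "\<dots> \<longleftrightarrow> (\<exists>n\<in>Units M. x = n \<otimes>\<^bsub>M\<^esub> y)"
      using inj_onD[OF e_inj] that M.Units_closed by (metis M.m_closed)
    finally show ?thesis .
  qed
  \<comment> \<open>\<open>r\<close> is a section of the surjection \<open>g\<close>, hence
    injective on \<open>carrier Q\<close>, and its values lie in \<open>'u\<close>.\<close>
  define r where "r = inv_into (carrier M) g"
  have r_inj: "inj_on r (carrier Q)"
    unfolding r_def using inj_on_inv_into[of "carrier Q" g "carrier M"] g_img by simp
  define Y where "Y = image_group r Q"
  have r_iso: "r \<in> iso Q Y"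
    unfolding Y_def by (rule inj_imp_image_group_iso[OF r_inj])
  \<comment> \<open>\<open>image_group\<close> already has this carrier and this unit, so the record
    update changes nothing and the fact about images of monoids applies to \<open>Y\<close>.\<close>
  have "monoid (Y\<lparr>carrier := r ` carrier Q, one := r \<one>\<^bsub>Q\<^esub>\<rparr>)"
    using r_iso by (intro monoid.hom_imp_img_monoid[OF mon_ge0_imp_monoid[OF Q]]) (simp add: iso_def)
  then have Ym: "monoid Y"
    by (simp add: Y_def image_group_def)
  show ?thesis
  proof (rule that)
    show "mon_ge0 Y" by (rule mon_ge0_iso[OF Q r_iso Ym])
    show "compose (carrier M) r g \<in> monoid_homs M Y"
      by (rule compose_monoid_homs[OF M.monoid_axioms g
            iso_imp_monoid_homs[OF mon_ge0_imp_monoid[OF Q] Ym r_iso]])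
    show "compose (carrier M) r g ` carrier M = carrier Y"
      by (simp add: compose_def Y_def image_group_def image_image flip: g_img)
    fix x y assume xy: "x \<in> carrier M" "y \<in> carrier M"
    then have "r (g x) = r (g y) \<longleftrightarrow> g x = g y"
      using inj_on_eq_iff[OF r_inj] g_img by blast
    with xy show "compose (carrier M) r g x = compose (carrier M) r g y
        \<longleftrightarrow> (\<exists>n\<in>Units M. x = n \<otimes>\<^bsub>M\<^esub> y)"
      using g_eq by (simp add: compose_eq)
  qed
qed

section \<open>The torsion theory\<close>

lemma MonGe0_simps:
  "M \<in> Obj MonGe0 \<longleftrightarrow> mon_ge0 M"
  "(A, f, B) \<in> Arr MonGe0 \<longleftrightarrow>
     mon_ge0 A \<and> mon_ge0 B \<and> f \<in> monoid_homs A B \<and> f \<in> extensional (carrier A)"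
  "Dom MonGe0 (A, f, B) = A"
  "Cod MonGe0 (A, f, B) = B"
  "Id MonGe0 A = (A, restrict (\<lambda>x. x) (carrier A), A)"
  "Comp MonGe0 (B', g, C) (A, f, B) = (A, compose (carrier A) g f, C)"
  by (auto simp: MonGe0_def Mon_def mon_ge0_def concrete_cat_simps)

lemma Hom_MonGe0:
  "h \<in> Hom MonGe0 A B \<longleftrightarrow> mon_ge0 A \<and> mon_ge0 B \<and>
     (\<exists>f. h = (A, f, B) \<and> f \<in> monoid_homs A B \<and> f \<in> extensional (carrier A))"
  by (cases h) (auto simp: Hom_def MonGe0_simps)

lemma category_MonGe0: "category MonGe0"
  unfolding MonGe0_def Mon_def
proof (intro category_full_subcategory category_concrete_cat)
  fix A :: "'a monoid" assume "A \<in> {M. monoid M}"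
  then interpret monoid A by simp
  show "restrict (\<lambda>x. x) (carrier A) \<in> monoid_homs A A"
    by (auto intro: monoid_homsI)
qed (auto intro: compose_monoid_homs monoid_homsD)

text \<open>The identity of a zero object agrees with the constant map at its unit, so no other
  element exists. Conversely, only the constant map goes into a one-element monoid, and a map out of
  it is fixed by preserving the unit.\<close>

lemma zero_object_MonGe0_iff:
  fixes Z :: "'a monoid"
  shows "zero_object MonGe0 Z \<longleftrightarrow> mon_ge0 Z \<and> carrier Z = {\<one>\<^bsub>Z\<^esub>}"
proof
  assume Z: "zero_object MonGe0 Z"
  then have Zm: "mon_ge0 Z" by (simp add: zero_object_def MonGe0_simps)
  then interpret monoid Z by (rule mon_ge0_imp_monoid)
  have "(Z, restrict (\<lambda>x. x) (carrier Z), Z) \<in> Hom MonGe0 Z Z"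
    using Zm by (auto simp: Hom_MonGe0 intro: monoid_homsI)
  moreover have "(Z, restrict (\<lambda>x. \<one>\<^bsub>Z\<^esub>) (carrier Z), Z) \<in> Hom MonGe0 Z Z"
    using Zm by (auto simp: Hom_MonGe0 intro: monoid_homsI)
  moreover have "\<exists>!h. h \<in> Hom MonGe0 Z Z"
    using Z unfolding zero_object_def by blast
  ultimately have "restrict (\<lambda>x. x) (carrier Z) = restrict (\<lambda>x. \<one>\<^bsub>Z\<^esub>) (carrier Z)"
    by blast
  then show "mon_ge0 Z \<and> carrier Z = {\<one>\<^bsub>Z\<^esub>}"
    using Zm one_closed by (auto dest: fun_cong simp: restrict_apply) (metis restrict_apply)
next
  assume "mon_ge0 Z \<and> carrier Z = {\<one>\<^bsub>Z\<^esub>}"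
  then have Zm: "mon_ge0 Z" and Z: "carrier Z = {\<one>\<^bsub>Z\<^esub>}" by auto
  interpret Z: monoid Z using Zm by (rule mon_ge0_imp_monoid)
  show "zero_object MonGe0 Z"
    unfolding zero_object_def
  proof (intro conjI ballI)
    show "Z \<in> Obj MonGe0" using Zm by (simp add: MonGe0_simps)
    fix A :: "'a monoid" assume "A \<in> Obj MonGe0"
    then have Am: "mon_ge0 A" by (simp add: MonGe0_simps)
    interpret A: monoid A using Am by (rule mon_ge0_imp_monoid)
    show "\<exists>!f. f \<in> Hom MonGe0 A Z"
    proof
      show "(A, restrict (\<lambda>x. \<one>\<^bsub>Z\<^esub>) (carrier A), Z) \<in> Hom MonGe0 A Z"
        using Am Zm by (auto simp: Hom_MonGe0 intro: monoid_homsI)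
      fix h assume "h \<in> Hom MonGe0 A Z"
      then show "h = (A, restrict (\<lambda>x. \<one>\<^bsub>Z\<^esub>) (carrier A), Z)"
        using monoid_homsD(1) Z by (fastforce simp: Hom_MonGe0 extensional_def)
    qed
    show "\<exists>!f. f \<in> Hom MonGe0 Z A"
    proof
      show "(Z, restrict (\<lambda>x. \<one>\<^bsub>A\<^esub>) (carrier Z), A) \<in> Hom MonGe0 Z A"
        using Am Zm by (auto simp: Hom_MonGe0 intro: monoid_homsI)
      fix h assume "h \<in> Hom MonGe0 Z A"
      then show "h = (Z, restrict (\<lambda>x. \<one>\<^bsub>A\<^esub>) (carrier Z), A)"
        using monoid_homsD(3) Z by (fastforce simp: Hom_MonGe0 extensional_def)
    qed
  qed
qed

lemma zero_object_MonGe0_exists: "\<exists>Z :: 'u monoid. zero_object MonGe0 Z"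
proof -
  \<comment> \<open>Every type is inhabited, so \<open>undefined\<close> can be the single element;
    embeddability comes from being a group.\<close>
  let ?Z = "\<lparr>carrier = {undefined :: 'u}, mult = (\<lambda>_ _. undefined), one = undefined\<rparr>"
  have "group ?Z" by (rule groupI) auto
  then have "zero_object MonGe0 ?Z"
    by (simp add: zero_object_MonGe0_iff group_imp_mon_ge0)
  then show ?thesis ..
qed

text \<open>Factoring through a one-element monoid forces the value to be the unit; conversely, the
  constant map at the unit factors through any zero object.\<close>

lemma zero_arrow_MonGe0_iff:
  fixes A B :: "'a monoid"
  assumes "(A, f, B) \<in> Arr MonGe0"
  shows "zero_arrow MonGe0 (A, f, B) \<longleftrightarrow> (\<forall>a\<in>carrier A. f a = \<one>\<^bsub>B\<^esub>)"
proof
  assume "zero_arrow MonGe0 (A, f, B)"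
  then obtain Z g' h' where Z: "zero_object MonGe0 Z" and "g' \<in> Hom MonGe0 A Z" "h' \<in> Hom MonGe0 Z B"
    "(A, f, B) = Comp MonGe0 h' g'"
    by (auto simp: zero_arrow_def MonGe0_simps(3,4))
  then obtain g h where "g \<in> monoid_homs A Z" "h \<in> monoid_homs Z B" "f = compose (carrier A) h g"
    by (auto simp: Hom_MonGe0 MonGe0_simps(6))
  moreover have "carrier Z = {\<one>\<^bsub>Z\<^esub>}" using Z by (simp add: zero_object_MonGe0_iff)
  ultimately
  show "\<forall>a\<in>carrier A. f a = \<one>\<^bsub>B\<^esub>"
    using monoid_homsD(1)[of g A Z] monoid_homsD(3)[of h Z B] by (auto simp: compose_eq)
next
  assume f: "\<forall>a\<in>carrier A. f a = \<one>\<^bsub>B\<^esub>"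
  obtain Z :: "'a monoid" where "zero_object MonGe0 Z"
    using zero_object_MonGe0_exists by blast
  then have Zm: "mon_ge0 Z" and Z: "carrier Z = {\<one>\<^bsub>Z\<^esub>}"
    by (auto simp: zero_object_MonGe0_iff)
  have AB: "mon_ge0 A" "mon_ge0 B" "f \<in> extensional (carrier A)"
    using assms by (auto simp: MonGe0_simps)
  interpret Z: monoid Z using Zm by (rule mon_ge0_imp_monoid)
  interpret A: monoid A using AB(1) by (rule mon_ge0_imp_monoid)
  interpret B: monoid B using AB(2) by (rule mon_ge0_imp_monoid)
  show "zero_arrow MonGe0 (A, f, B)"
    unfolding zero_arrow_def
  proof (intro exI conjI bexI)
    show "zero_object MonGe0 Z" by fact
    show "(A, restrict (\<lambda>x. \<one>\<^bsub>Z\<^esub>) (carrier A), Z) \<in> Hom MonGe0 (Dom MonGe0 (A, f, B)) Z"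
      using AB Zm by (auto simp: Hom_MonGe0 MonGe0_simps intro: monoid_homsI)
    show "(Z, restrict (\<lambda>x. \<one>\<^bsub>B\<^esub>) (carrier Z), B) \<in> Hom MonGe0 Z (Cod MonGe0 (A, f, B))"
      using AB Zm by (auto simp: Hom_MonGe0 MonGe0_simps intro: monoid_homsI)
    show "(A, f, B) = Comp MonGe0 (Z, restrict (\<lambda>x. \<one>\<^bsub>B\<^esub>) (carrier Z), B)
        (A, restrict (\<lambda>x. \<one>\<^bsub>Z\<^esub>) (carrier A), Z)"
      using AB f by (auto simp: MonGe0_simps compose_def extensional_def)
  qed
qed

section \<open>Short exact sequences\<close>

lemma Comp_MonGe0_in_Arr:
  assumes "(A, f, B) \<in> Arr MonGe0" "(B, g, C) \<in> Arr MonGe0"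
  shows "(A, compose (carrier A) g f, C) \<in> Arr MonGe0"
  using assms compose_monoid_homs[of A f B g C] mon_ge0_imp_monoid[of A] by (auto simp: MonGe0_simps)

text \<open>The fibre of \<open>q\<close> over the unit is \<open>Units X\<close>, the image of
  \<open>k\<close>, so whatever \<open>q\<close> kills lifts through the injection \<open>k\<close>.
  A map killing the units is constant on the fibres of \<open>q\<close> and so descends along the
  surjection \<open>q\<close>.\<close>

lemma short_exact_MonGe0I:
  assumes k: "(K, k, X) \<in> Arr MonGe0" and q: "(X, q, Y) \<in> Arr MonGe0"
    and k_inj: "inj_on k (carrier K)" and k_img: "k ` carrier K = Units X"
    and q_img: "q ` carrier X = carrier Y"
    and q_eq: "\<And>x y. x \<in> carrier X \<Longrightarrow> y \<in> carrier X \<Longrightarrow> q x = q y \<longleftrightarrow> (\<exists>n\<in>Units X. x = n \<otimes>\<^bsub>X\<^esub> y)"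
  shows "short_exact MonGe0 (K, k, X) (X, q, Y)"
proof -
  have Km: "mon_ge0 K" and Xm: "mon_ge0 X" and Ym: "mon_ge0 Y"
    and k_hom: "k \<in> monoid_homs K X" and q_hom: "q \<in> monoid_homs X Y"
    and q_ext: "q \<in> extensional (carrier X)"
    using k q by (auto simp: MonGe0_simps)
  interpret K: monoid K using Km by (rule mon_ge0_imp_monoid)
  interpret X: monoid X using Xm by (rule mon_ge0_imp_monoid)
  note k_D = monoid_homsD[OF k_hom] and q_D = monoid_homsD[OF q_hom]
  \<comment> \<open>This is \<open>q_eq\<close> with the unit as second element.\<close>
  have q_one: "q x = \<one>\<^bsub>Y\<^esub> \<longleftrightarrow> x \<in> Units X" if "x \<in> carrier X" for x
    using q_eq[OF that X.one_closed] q_D(3) X.Units_closed by auto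
  have zero: "zero_arrow MonGe0 (Comp MonGe0 (X, q, Y) (K, k, X))"
    using Comp_MonGe0_in_Arr[OF k q] q_one k_img X.Units_closed
    by (auto simp: MonGe0_simps(6) zero_arrow_MonGe0_iff compose_eq)
  have ker: "\<exists>!u. u \<in> Hom MonGe0 A K \<and> Comp MonGe0 (K, k, X) u = (A, h, X)"
    if h: "(A, h, X) \<in> Arr MonGe0"
      and hz: "zero_arrow MonGe0 (Comp MonGe0 (X, q, Y) (A, h, X))" for A h
  proof -
    have Am: "mon_ge0 A" and h_hom: "h \<in> monoid_homs A X" and h_ext: "h \<in> extensional (carrier A)"
      using h by (auto simp: MonGe0_simps)
    interpret A: monoid A using Am by (rule mon_ge0_imp_monoid)
    note h_D = monoid_homsD[OF h_hom]
    have h_units: "h a \<in> k ` carrier K" if "a \<in> carrier A" for a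
      using hz Comp_MonGe0_in_Arr[OF h q] q_one h_D(1) that k_img
      by (auto simp: MonGe0_simps(6) zero_arrow_MonGe0_iff compose_eq)
    define u where "u = restrict (\<lambda>a. inv_into (carrier K) k (h a)) (carrier A)"
    have u_mem: "u a \<in> carrier K" and ku: "k (u a) = h a" if "a \<in> carrier A" for a
      using inv_into_into[OF h_units[OF that]] f_inv_into_f[OF h_units[OF that]] that
      by (simp_all add: u_def)
    have u_hom: "u \<in> monoid_homs A K"
    proof (rule monoid_homsI)
      \<comment> \<open>Both sides agree after applying the injective \<open>k\<close>, because
        \<open>k\<close> after \<open>u\<close> is the homomorphism \<open>h\<close>.\<close>
      show "u (a \<otimes>\<^bsub>A\<^esub> b) = u a \<otimes>\<^bsub>K\<^esub> u b" if "a \<in> carrier A" "b \<in> carrier A" for a b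
        by (rule inj_onD[OF k_inj]) (simp_all add: that u_mem ku k_D(2) h_D(2))
      show "u \<one>\<^bsub>A\<^esub> = \<one>\<^bsub>K\<^esub>"
        by (rule inj_onD[OF k_inj]) (simp_all add: u_mem ku k_D(3) h_D(3))
    qed (rule u_mem)
    have u_ext: "u \<in> extensional (carrier A)"
      by (simp add: u_def)
    have ku_comp: "compose (carrier A) k u = h"
      by (rule extensionalityI[of _ "carrier A"]) (simp_all add: compose_eq ku h_ext)
    show ?thesis
    proof
      show "(A, u, K) \<in> Hom MonGe0 A K \<and> Comp MonGe0 (K, k, X) (A, u, K) = (A, h, X)"
        using Am Km u_hom u_ext ku_comp by (simp add: Hom_MonGe0 MonGe0_simps)
      fix v assume "v \<in> Hom MonGe0 A K \<and> Comp MonGe0 (K, k, X) v = (A, h, X)"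
      then obtain v' where v: "v = (A, v', K)" "v' \<in> monoid_homs A K" "v' \<in> extensional (carrier A)"
        "compose (carrier A) k v' = h"
        by (auto simp: Hom_MonGe0 MonGe0_simps)
      \<comment> \<open>Two lifts of \<open>h\<close> have the same composite with the injective
        \<open>k\<close>.\<close>
      have "v' a = u a" if "a \<in> carrier A" for a
      proof (rule inj_onD[OF k_inj])
        show "k (v' a) = k (u a)"
          using fun_cong[OF v(4), of a] ku[OF that] that by (simp add: compose_eq)
      qed (rule monoid_homsD(1)[OF v(2) that] u_mem[OF that])+
      then have "v' = u"
        using v(3) by (auto intro!: extensionalityI[of _ "carrier A"] simp: u_def)
      then show "v = (A, u, K)" using v(1) by simp
    qed
  qed
  have coker: "\<exists>!u. u \<in> Hom MonGe0 Y B \<and> Comp MonGe0 u (X, q, Y) = (X, h, B)"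
    if h: "(X, h, B) \<in> Arr MonGe0"
      and hz: "zero_arrow MonGe0 (Comp MonGe0 (X, h, B) (K, k, X))" for h B
  proof -
    have Bm: "mon_ge0 B" and h_hom: "h \<in> monoid_homs X B" and h_ext: "h \<in> extensional (carrier X)"
      using h by (auto simp: MonGe0_simps)
    interpret B: monoid B using Bm by (rule mon_ge0_imp_monoid)
    interpret Y: monoid Y using Ym by (rule mon_ge0_imp_monoid)
    note h_D = monoid_homsD[OF h_hom]
    have h_units: "h n = \<one>\<^bsub>B\<^esub>" if "n \<in> Units X" for n
      using hz Comp_MonGe0_in_Arr[OF k h] that unfolding k_img[symmetric]
      by (auto simp: MonGe0_simps(6) zero_arrow_MonGe0_iff compose_eq)
    have h_eq: "h x = h y" if xy: "x \<in> carrier X" "y \<in> carrier X" "q x = q y" for x y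
    proof -
      \<comment> \<open>From \<open>x = n + y\<close> with \<open>n\<close> a unit,
        \<open>h x = h y\<close> follows because \<open>h\<close> kills \<open>n\<close>.\<close>
      obtain n where n: "n \<in> Units X" "x = n \<otimes>\<^bsub>X\<^esub> y" using q_eq xy by blast
      then show ?thesis using h_D xy X.Units_closed[OF n(1)] h_units[OF n(1)] by simp
    qed
    \<comment> \<open>The preimage is an arbitrary choice; \<open>h_eq\<close> shows that the value
      does not depend on it.\<close>
    define u where "u = restrict (\<lambda>y. h (inv_into (carrier X) q y)) (carrier Y)"
    have uq: "u (q x) = h x" if "x \<in> carrier X" for x
    proof -
      have qx: "q x \<in> q ` carrier X" using that by simp
      have "h (inv_into (carrier X) q (q x)) = h x"
        by (rule h_eq[OF inv_into_into[OF qx] that f_inv_into_f[OF qx]])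
      then show ?thesis
        using q_D(1)[OF that] by (simp add: u_def)
    qed
    have Y_cases: "\<exists>x\<in>carrier X. y = q x" if "y \<in> carrier Y" for y
      using that q_img by blast
    have u_hom: "u \<in> monoid_homs Y B"
    proof (rule monoid_homsI)
      show "u y \<in> carrier B" if "y \<in> carrier Y" for y
        using Y_cases[OF that] uq h_D(1) by auto
      show "u (y \<otimes>\<^bsub>Y\<^esub> z) = u y \<otimes>\<^bsub>B\<^esub> u z" if yz: "y \<in> carrier Y" "z \<in> carrier Y" for y z
      proof -
        obtain a b where "a \<in> carrier X" "b \<in> carrier X" "y = q a" "z = q b"
          using yz Y_cases by metis
        then show ?thesis
          using uq[of "a \<otimes>\<^bsub>X\<^esub> b"] by (simp add: uq q_D(2) h_D(2))
      qed
      show "u \<one>\<^bsub>Y\<^esub> = \<one>\<^bsub>B\<^esub>"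
        using uq[OF X.one_closed] by (simp add: q_D(3) h_D(3))
    qed
    have u_ext: "u \<in> extensional (carrier Y)"
      by (simp add: u_def)
    have uq_comp: "compose (carrier X) u q = h"
      by (rule extensionalityI[of _ "carrier X"]) (simp_all add: compose_eq uq h_ext)
    show ?thesis
    proof
      show "(Y, u, B) \<in> Hom MonGe0 Y B \<and> Comp MonGe0 (Y, u, B) (X, q, Y) = (X, h, B)"
        using Ym Bm u_hom u_ext uq_comp by (simp add: Hom_MonGe0 MonGe0_simps)
      fix v assume "v \<in> Hom MonGe0 Y B \<and> Comp MonGe0 v (X, q, Y) = (X, h, B)"
      then obtain v' where v: "v = (Y, v', B)" "v' \<in> extensional (carrier Y)"
        "compose (carrier X) v' q = h"
        by (auto simp: Hom_MonGe0 MonGe0_simps)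
      \<comment> \<open>The values on the image of \<open>q\<close> are forced, and \<open>q\<close>
        is surjective.\<close>
      have "v' (q x) = u (q x)" if "x \<in> carrier X" for x
        using v(3) uq[OF that] that by (auto simp: compose_eq)
      then have "v' y = u y" if "y \<in> carrier Y" for y
        using Y_cases[OF that] by auto
      then have "v' = u"
        using v(2) by (auto intro!: extensionalityI[of _ "carrier Y"] simp: u_def)
      then show "v = (Y, u, B)" using v(1) by simp
    qed
  qed
  have "is_kernel MonGe0 (K, k, X) (X, q, Y)"
    unfolding is_kernel_def
  proof (intro conjI ballI impI)
    fix h assume h: "h \<in> Arr MonGe0" "Cod MonGe0 h = Dom MonGe0 (X, q, Y)"
      "zero_arrow MonGe0 (Comp MonGe0 (X, q, Y) h)"
    obtain A h' where "h = (A, h', X)"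
      using h(2) by (cases h) (simp add: MonGe0_simps(3,4))
    with h ker show "\<exists>!u. u \<in> Hom MonGe0 (Dom MonGe0 h) (Dom MonGe0 (K, k, X)) \<and>
        Comp MonGe0 (K, k, X) u = h"
      by (simp only: MonGe0_simps(3))
  qed (simp_all only: k q zero MonGe0_simps(3,4))
  moreover have "is_cokernel MonGe0 (X, q, Y) (K, k, X)"
    unfolding is_cokernel_def
  proof (intro conjI ballI impI)
    fix h assume h: "h \<in> Arr MonGe0" "Dom MonGe0 h = Cod MonGe0 (K, k, X)"
      "zero_arrow MonGe0 (Comp MonGe0 h (K, k, X))"
    obtain B h' where "h = (X, h', B)"
      using h(2) by (cases h) (simp add: MonGe0_simps(3,4))
    with h coker show "\<exists>!u. u \<in> Hom MonGe0 (Cod MonGe0 (X, q, Y)) (Cod MonGe0 h) \<and>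
        Comp MonGe0 u (X, q, Y) = h"
      by (simp only: MonGe0_simps(4))
  qed (simp_all only: k q zero MonGe0_simps(3,4))
  ultimately show ?thesis
    by (simp add: short_exact_def)
qed

text \<open>Let \<open>q b\<close> be inverse to \<open>q a\<close>. Both products of
  \<open>a\<close> and \<open>b\<close> lie over the unit, so they are units of \<open>M\<close>.
  Then \<open>a\<close> has a left and a right inverse, is itself a unit, and is killed by
  \<open>q\<close>.\<close>

lemma Units_quotient_Units:
  assumes M: "monoid M" and Y: "monoid Y" and q: "q \<in> monoid_homs M Y"
    and q_img: "q ` carrier M = carrier Y"
    and q_eq: "\<And>x y. x \<in> carrier M \<Longrightarrow> y \<in> carrier M \<Longrightarrow> q x = q y \<longleftrightarrow> (\<exists>n\<in>Units M. x = n \<otimes>\<^bsub>M\<^esub> y)"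
  shows "Units Y = {\<one>\<^bsub>Y\<^esub>}"
proof -
  interpret M: monoid M by fact
  interpret Y: monoid Y by fact
  note q_D = monoid_homsD[OF q]
  have q_one: "q x = \<one>\<^bsub>Y\<^esub> \<longleftrightarrow> x \<in> Units M" if "x \<in> carrier M" for x
    using q_eq[OF that M.one_closed] q_D(3) M.Units_closed by auto
  have "y = \<one>\<^bsub>Y\<^esub>" if y: "y \<in> Units Y" for y
  proof -
    obtain z where z: "z \<in> carrier Y" "z \<otimes>\<^bsub>Y\<^esub> y = \<one>\<^bsub>Y\<^esub>" "y \<otimes>\<^bsub>Y\<^esub> z = \<one>\<^bsub>Y\<^esub>" "y \<in> carrier Y"
      using y by (auto simp: Units_def)
    obtain a b where ab: "a \<in> carrier M" "b \<in> carrier M" "y = q a" "z = q b"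
      using z q_img by (metis imageE)
    have "q (b \<otimes>\<^bsub>M\<^esub> a) = \<one>\<^bsub>Y\<^esub>" "q (a \<otimes>\<^bsub>M\<^esub> b) = \<one>\<^bsub>Y\<^esub>"
      using ab z q_D(2) by auto
    then have "b \<otimes>\<^bsub>M\<^esub> a \<in> Units M" "a \<otimes>\<^bsub>M\<^esub> b \<in> Units M"
      using ab q_one by auto
    then obtain s t where st: "s \<in> carrier M" "s \<otimes>\<^bsub>M\<^esub> (b \<otimes>\<^bsub>M\<^esub> a) = \<one>\<^bsub>M\<^esub>"
      "t \<in> carrier M" "(a \<otimes>\<^bsub>M\<^esub> b) \<otimes>\<^bsub>M\<^esub> t = \<one>\<^bsub>M\<^esub>"
      by (auto simp: Units_def)
    have sb: "(s \<otimes>\<^bsub>M\<^esub> b) \<otimes>\<^bsub>M\<^esub> a = \<one>\<^bsub>M\<^esub>" and bt: "a \<otimes>\<^bsub>M\<^esub> (b \<otimes>\<^bsub>M\<^esub> t) = \<one>\<^bsub>M\<^esub>"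
      using st ab by (simp_all add: M.m_assoc)
    \<comment> \<open>A left inverse and a right inverse of the same element coincide.\<close>
    have "s \<otimes>\<^bsub>M\<^esub> b = b \<otimes>\<^bsub>M\<^esub> t"
      using M.inv_unique[OF sb bt] st ab by simp
    then have "a \<otimes>\<^bsub>M\<^esub> (s \<otimes>\<^bsub>M\<^esub> b) = \<one>\<^bsub>M\<^esub>"
      using bt by simp
    with sb have "a \<in> Units M"
      using ab st by (auto simp: Units_def)
    then show ?thesis using q_one ab by simp
  qed
  then show ?thesis using Y.Units_one_closed by blast
qed

section \<open>Repleteness and the torsion theory axioms\<close>

lemma iso_objects_MonGe0_imp_iso:
  assumes "iso_objects MonGe0 A B"
  obtains e where "mon_ge0 A" "mon_ge0 B" "e \<in> iso A B"
proof -
  obtain f g where AB: "mon_ge0 A" "mon_ge0 B" and f: "f \<in> monoid_homs A B" and g: "g \<in> monoid_homs B A"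
    and gf: "compose (carrier A) g f = restrict (\<lambda>x. x) (carrier A)"
    and fg: "compose (carrier B) f g = restrict (\<lambda>x. x) (carrier B)"
    using assms by (auto simp: iso_objects_def Hom_MonGe0 MonGe0_simps)
  have "g (f a) = a" if "a \<in> carrier A" for a
    using fun_cong[OF gf, of a] that by (simp add: compose_eq)
  moreover have "f (g b) = b" if "b \<in> carrier B" for b
    using fun_cong[OF fg, of b] that by (simp add: compose_eq)
  ultimately have "bij_betw f (carrier A) (carrier B)"
    using monoid_homsD(1)[OF f] monoid_homsD(1)[OF g] by (intro bij_betw_byWitness[of _ g]) auto
  then have "f \<in> iso A B"
    using f by (simp add: iso_def monoid_homs_def)
  with AB show ?thesis by (rule that)
qed

lemma replete_GrpObj: "replete MonGe0 GrpObj"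
proof -
  have "group B" if A: "group A" and iso: "iso_objects MonGe0 A B" for A B :: "'a monoid"
  proof -
    obtain e where "mon_ge0 A" "mon_ge0 B" "e \<in> iso A B"
      using iso_objects_MonGe0_imp_iso[OF iso] .
    then show ?thesis
      using group.iso_imp_group[OF A] mon_ge0_imp_monoid by (auto simp: is_iso_def)
  qed
  then show ?thesis by (auto simp: replete_def GrpObj_def)
qed

text \<open>The inverse isomorphism sends a unit of \<open>B\<close> to a unit of \<open>A\<close>,
  which is trivial; injectivity then makes the unit of \<open>B\<close> trivial.\<close>

lemma replete_RedMonGe0Obj: "replete MonGe0 RedMonGe0Obj"
proof -
  have "Units B = {\<one>\<^bsub>B\<^esub>}" if A: "Units A = {\<one>\<^bsub>A\<^esub>}" and iso: "iso_objects MonGe0 A B" for A B :: "'a monoid"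
  proof -
    obtain e where AB: "mon_ge0 A" "mon_ge0 B" and e: "e \<in> iso A B"
      using iso_objects_MonGe0_imp_iso[OF iso] .
    interpret A: monoid A using AB(1) by (rule mon_ge0_imp_monoid)
    interpret B: monoid B using AB(2) by (rule mon_ge0_imp_monoid)
    let ?e' = "inv_into (carrier A) e"
    have e': "?e' \<in> monoid_homs B A"
      by (rule iso_imp_monoid_homs[OF B.monoid_axioms A.monoid_axioms iso_inv_into[OF A.monoid_axioms e]])
    have "b = \<one>\<^bsub>B\<^esub>" if "b \<in> Units B" for b
    proof -
      have "?e' b = ?e' \<one>\<^bsub>B\<^esub>"
        using monoid_homs_Units[OF B.monoid_axioms e' that] A monoid_homsD(3)[OF e'] by simp
      then show ?thesis
        using e B.Units_closed[OF that] by (auto simp: iso_def bij_betw_def dest: inv_into_injective)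
    qed
    then show ?thesis using B.Units_one_closed by blast
  qed
  then show ?thesis by (auto simp: replete_def RedMonGe0Obj_def)
qed

text \<open>All elements of a group are units and homomorphisms preserve units, so arrows into
  reduced monoids vanish. The torsion part of \<open>X\<close> is its group of units, the
  torsion-free part its quotient by them.\<close>

lemma torsion_theory_MonGe0: "torsion_theory MonGe0 GrpObj RedMonGe0Obj"
  unfolding torsion_theory_def
proof (intro conjI ballI)
  show "replete MonGe0 GrpObj" by (rule replete_GrpObj)
  show "replete MonGe0 RedMonGe0Obj" by (rule replete_RedMonGe0Obj)
next
  fix A B :: "'a monoid" and h
  assume A: "A \<in> GrpObj" and B: "B \<in> RedMonGe0Obj" and h: "h \<in> Hom MonGe0 A B"
  then obtain f where f: "h = (A, f, B)" "f \<in> monoid_homs A B"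
    by (auto simp: Hom_MonGe0)
  interpret A: group A using A by (simp add: GrpObj_def)
  have "f a = \<one>\<^bsub>B\<^esub>" if "a \<in> carrier A" for a
    using monoid_homs_Units[OF A.monoid_axioms f(2), of a] B that by (auto simp: RedMonGe0Obj_def)
  then show "zero_arrow MonGe0 h"
    using h f zero_arrow_MonGe0_iff[of A f B] by (simp add: Hom_def)
next
  fix X :: "'a monoid" assume "X \<in> Obj MonGe0"
  then have X: "mon_ge0 X" by (simp add: MonGe0_simps)
  interpret X: monoid X using X by (rule mon_ge0_imp_monoid)
  obtain Y q where Y: "mon_ge0 (Y :: 'a monoid)" and q: "q \<in> monoid_homs X Y"
    and q_img: "q ` carrier X = carrier Y"
    and q_eq: "\<And>x y. x \<in> carrier X \<Longrightarrow> y \<in> carrier X \<Longrightarrow> q x = q y \<longleftrightarrow> (\<exists>n\<in>Units X. x = n \<otimes>\<^bsub>X\<^esub> y)"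
    using mon_ge0_quotient_Units[OF X] by metis
  \<comment> \<open>Both maps are restricted because arrows of \<open>MonGe0\<close> must be
    extensional.\<close>
  let ?K = "units_of X" and ?k = "restrict (\<lambda>x. x) (Units X)" and ?q = "restrict q (carrier X)"
  have K: "group ?K" by (rule X.units_group)
  have Km: "mon_ge0 ?K" by (rule group_imp_mon_ge0[OF K])
  have k: "?k \<in> monoid_homs ?K X"
    by (auto simp: units_of_carrier units_of_mult units_of_one intro!: monoid_homsI)
  have "short_exact MonGe0 (?K, ?k, X) (X, ?q, Y)"
  proof (rule short_exact_MonGe0I)
    show "(?K, ?k, X) \<in> Arr MonGe0"
      using Km X k by (simp add: MonGe0_simps units_of_carrier)
    show "(X, ?q, Y) \<in> Arr MonGe0"
      using X Y restrict_monoid_homs[OF X.monoid_axioms q] by (simp add: MonGe0_simps)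
    show "inj_on ?k (carrier ?K)" "?k ` carrier ?K = Units X"
      by (simp_all add: units_of_carrier inj_on_def)
    show "?q ` carrier X = carrier Y" using q_img by simp
    show "?q x = ?q y \<longleftrightarrow> (\<exists>n\<in>Units X. x = n \<otimes>\<^bsub>X\<^esub> y)" if "x \<in> carrier X" "y \<in> carrier X" for x y
      using q_eq that by simp
  qed
  moreover have "?K \<in> GrpObj" using Km K by (simp add: GrpObj_def MonGe0_simps)
  moreover have "Y \<in> RedMonGe0Obj"
    using Y Units_quotient_Units[OF X.monoid_axioms mon_ge0_imp_monoid[OF Y] q q_img q_eq]
    by (simp add: RedMonGe0Obj_def MonGe0_simps)
  ultimately show "\<exists>k q. short_exact MonGe0 k q \<and> Dom MonGe0 k \<in> GrpObj \<and>
      Cod MonGe0 k = X \<and> Cod MonGe0 q \<in> RedMonGe0Obj"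
    by (intro exI[of _ "(?K, ?k, X)"] exI[of _ "(X, ?q, Y)"]) (simp add: MonGe0_simps)
qed

section \<open>The positive cone functor\<close>

lemma PreOrdGrp_simps:
  "X \<in> Obj PreOrdGrp \<longleftrightarrow> preordered_group X"
  "((G, P), f, (H, Q)) \<in> Arr PreOrdGrp \<longleftrightarrow> preordered_group (G, P) \<and> preordered_group (H, Q) \<and>
     f \<in> hom G H \<and> f ` P \<subseteq> Q \<and> f \<in> extensional (carrier G)"
  "Dom PreOrdGrp (X, f, Y) = X"
  "Cod PreOrdGrp (X, f, Y) = Y"
  "Id PreOrdGrp (G, P) = ((G, P), restrict (\<lambda>x. x) (carrier G), (G, P))"
  "Comp PreOrdGrp (Y', g, Z) ((G, P), f, Y) = ((G, P), compose (carrier G) g f, Z)"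
  by (auto simp: PreOrdGrp_def concrete_cat_simps preord_grp_homs_def)

lemma preordered_groupD:
  assumes "preordered_group (G, P)"
  shows "group G" "P \<subseteq> carrier G" "\<one>\<^bsub>G\<^esub> \<in> P"
  using assms by (auto simp: preordered_group_def submonoid_def)

lemma category_PreOrdGrp: "category PreOrdGrp"
  unfolding PreOrdGrp_def
proof (rule category_concrete_cat, goal_cases)
  case (1 A B f x)
  then show ?case by (auto simp: preord_grp_homs_def hom_def split: prod.splits)
next
  case (2 A)
  obtain G P where A: "A = (G, P)" by (cases A)
  interpret group G using 2 preordered_groupD(1) by (auto simp: A)
  show ?case
    using 2 preordered_groupD(2)[of G P] by (auto simp: A preord_grp_homs_def hom_def)
next
  case (3 A B C f g)
  obtain G P where A: "A = (G, P)" by (cases A)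
  obtain H Q where B: "B = (H, Q)" by (cases B)
  obtain K R where C: "C = (K, R)" by (cases C)
  interpret group G using 3 preordered_groupD(1) by (auto simp: A)
  show ?case
    using 3 preordered_groupD(2)[of G P]
    by (auto simp: A B C preord_grp_homs_def compose_def hom_def Pi_def image_subset_iff)
qed

lemma is_functor_pos_cone: "is_functor PreOrdGrp MonGe0 pos_cone pos_cone_arr"
  unfolding is_functor_def
proof (intro conjI ballI impI)
  show "category PreOrdGrp" by (rule category_PreOrdGrp)
  show "category MonGe0" by (rule category_MonGe0)
next
  fix A :: "'a preord_grp" assume A: "A \<in> Obj PreOrdGrp"
  then show "pos_cone A \<in> Obj MonGe0"
    by (simp add: MonGe0_simps PreOrdGrp_simps mon_ge0_pos_cone)
  obtain G P where GP: "A = (G, P)" by (cases A)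
  show "pos_cone_arr (Id PreOrdGrp A) = Id MonGe0 (pos_cone A)"
    using A preordered_groupD(2)[of G P]
    by (auto simp: GP MonGe0_simps PreOrdGrp_simps pos_cone_arr_def fun_eq_iff)
next
  fix a :: "'a preord_grp_arr" assume a: "a \<in> Arr PreOrdGrp"
  obtain G P f H Q where eq: "a = ((G, P), f, (H, Q))" by (metis prod.exhaust)
  have GP: "preordered_group (G, P)" "preordered_group (H, Q)" and f: "f \<in> hom G H" "f ` P \<subseteq> Q"
    using a by (auto simp: eq PreOrdGrp_simps)
  \<comment> \<open>Between groups the unit is preserved automatically, but
    \<open>monoid_homs\<close> asks for it explicitly.\<close>
  have "f \<one>\<^bsub>G\<^esub> = \<one>\<^bsub>H\<^esub>"
    using f GP preordered_groupD(1) by (blast intro: hom_one)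
  then have "f \<in> monoid_homs (pos_cone (G, P)) (pos_cone (H, Q))"
    using f preordered_groupD(2)[OF GP(1)] by (intro monoid_homsI) (auto simp: subset_iff hom_mult)
  then have "restrict f (carrier (pos_cone (G, P))) \<in> monoid_homs (pos_cone (G, P)) (pos_cone (H, Q))"
    by (rule restrict_monoid_homs[OF mon_ge0_imp_monoid[OF mon_ge0_pos_cone[OF GP(1)]]])
  then show "pos_cone_arr a \<in> Hom MonGe0 (pos_cone (Dom PreOrdGrp a)) (pos_cone (Cod PreOrdGrp a))"
    using GP by (auto simp: eq PreOrdGrp_simps pos_cone_arr_def Hom_MonGe0 mon_ge0_pos_cone)
next
  fix a b :: "'a preord_grp_arr"
  assume a: "a \<in> Arr PreOrdGrp" and b: "b \<in> Arr PreOrdGrp" and ab: "Cod PreOrdGrp a = Dom PreOrdGrp b"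
  obtain G P f H Q where a_eq: "a = ((G, P), f, (H, Q))" by (metis prod.exhaust)
  obtain g K R where b_eq: "b = ((H, Q), g, (K, R))"
    using ab by (cases b) (auto simp: a_eq PreOrdGrp_simps)
  \<comment> \<open>Because \<open>f\<close> maps \<open>P\<close> into \<open>Q\<close>,
    restricting to the cones before or after composing gives the same map.\<close>
  have "P \<subseteq> carrier G" "f ` P \<subseteq> Q"
    using a preordered_groupD(2)[of G P] by (auto simp: a_eq PreOrdGrp_simps)
  then show "pos_cone_arr (Comp PreOrdGrp b a) = Comp MonGe0 (pos_cone_arr b) (pos_cone_arr a)"
    by (auto simp: a_eq b_eq PreOrdGrp_simps MonGe0_simps pos_cone_arr_def compose_def fun_eq_iff)
qed

text \<open>By \<open>Units_pos_cone\<close>, the first cone consists of the units of the second,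
  and the fibres of the quotient map are the orbits of these units, so
  \<open>short_exact_MonGe0I\<close> applies.\<close>

lemma short_exact_pos_cone:
  assumes "preordered_group X"
  shows "short_exact MonGe0 (pos_cone_arr (canonical_mono X)) (pos_cone_arr (canonical_epi X))"
proof -
  obtain G P where X: "X = (G, P)" by (cases X)
  note GP = assms[unfolded X]
  let ?N = "pos_neg (G, P)" and ?\<eta> = "quotient_map G (pos_neg (G, P))"
  let ?K = "pos_cone (G, ?N)" and ?P = "pos_cone (G, P)"
    and ?Y = "pos_cone (quotient_group G ?N, ?\<eta> ` P)"
  note P_sub = preordered_groupD(2)[OF GP] and N_sub = pos_neg_subset[OF GP]
  \<comment> \<open>The identity of \<open>G\<close>, restricted to the smaller cone, becomes the
    inclusion of \<open>pos_neg\<close> into \<open>P\<close>.\<close>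
  have mono: "pos_cone_arr (canonical_mono X) = (?K, restrict (\<lambda>x. x) ?N, ?P)"
    using P_sub N_sub by (auto simp: X canonical_mono_def pos_cone_arr_def fun_eq_iff)
  have epi: "pos_cone_arr (canonical_epi X) = (?P, restrict ?\<eta> P, ?Y)"
    by (simp add: X canonical_epi_def pos_cone_arr_def Let_def)
  have Pm: "monoid ?P"
    by (rule mon_ge0_imp_monoid[OF mon_ge0_pos_cone[OF GP]])
  have K: "mon_ge0 ?K"
    by (rule mon_ge0_pos_cone[OF preordered_group_pos_neg[OF GP]])
  have k: "restrict (\<lambda>x. x) ?N \<in> monoid_homs ?K ?P"
    using N_sub mon_ge0_imp_monoid[OF K, THEN monoid.m_closed]
      mon_ge0_imp_monoid[OF K, THEN monoid.one_closed]
    by (intro monoid_homsI) auto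
  show ?thesis
    unfolding mono epi
  proof (rule short_exact_MonGe0I)
    show "(?K, restrict (\<lambda>x. x) ?N, ?P) \<in> Arr MonGe0"
      using K k mon_ge0_pos_cone[OF GP] by (simp add: MonGe0_simps)
    show "(?P, restrict ?\<eta> P, ?Y) \<in> Arr MonGe0"
      using restrict_monoid_homs[OF Pm canonical_quotient_monoid_homs[OF GP]]
        mon_ge0_pos_cone[OF GP] mon_ge0_pos_cone[OF preordered_group_quotient[OF GP]]
      by (simp add: MonGe0_simps)
    show "inj_on (restrict (\<lambda>x. x) ?N) (carrier ?K)" "restrict (\<lambda>x. x) ?N ` carrier ?K = Units ?P"
      by (simp_all add: inj_on_def Units_pos_cone[OF GP])
    \<comment> \<open>Surjectivity is immediate: the cone of the quotient was taken to be the image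
      of \<open>P\<close>.\<close>
    show "restrict ?\<eta> P ` carrier ?P = carrier ?Y" by simp
    show "restrict ?\<eta> P x = restrict ?\<eta> P y \<longleftrightarrow> (\<exists>n\<in>Units ?P. x = n \<otimes>\<^bsub>?P\<^esub> y)"
      if "x \<in> carrier ?P" "y \<in> carrier ?P" for x y
      using canonical_quotient_eq_iff[OF GP, of x y] that by simp
  qed
qed

theorem proposition4p4:
  shows "torsion_theory_functor
    (MonGe0 :: ('u monoid, 'u mon_arr) cat) GrpObj RedMonGe0Obj
    (pos_cone :: 'u preord_grp \<Rightarrow> 'u monoid) pos_cone_arr"
  unfolding torsion_theory_functor_def pointed_category_def
proof (intro conjI ballI)
  show "pos_cone X \<in> GrpObj" if "X \<in> GrpPreOrdObj" for X :: "'u preord_grp"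
    using that by (simp add: GrpPreOrdObj_def GrpObj_def PreOrdGrp_simps MonGe0_simps mon_ge0_pos_cone)
  show "pos_cone X \<in> RedMonGe0Obj" if par: "X \<in> ParOrdGrpObj" for X :: "'u preord_grp"
  proof -
    obtain G P where X: "X = (G, P)" by (cases X)
    have GP: "preordered_group (G, P)" and red: "\<forall>x\<in>P. inv\<^bsub>G\<^esub> x \<in> P \<longrightarrow> x = \<one>\<^bsub>G\<^esub>"
      using par by (simp_all add: X ParOrdGrpObj_def PreOrdGrp_simps)
    interpret group G by (rule preordered_groupD(1)[OF GP])
    \<comment> \<open>Reducedness in the sense of group inverses makes \<open>pos_neg\<close>
      trivial; \<open>Units_pos_cone\<close> then turns this into reducedness of the monoid.\<close>
    have "pos_neg (G, P) \<subseteq> {\<one>\<^bsub>G\<^esub>}"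
      unfolding pos_neg_def using red by blast
    moreover have "\<one>\<^bsub>G\<^esub> \<in> pos_neg (G, P)"
      using preordered_groupD(3)[OF GP] by (simp add: pos_neg_def)
    ultimately have "pos_neg (G, P) = {\<one>\<^bsub>G\<^esub>}" by blast
    then show ?thesis
      using GP by (simp add: X RedMonGe0Obj_def MonGe0_simps mon_ge0_pos_cone Units_pos_cone)
  qed
qed (auto simp: category_MonGe0 zero_object_MonGe0_exists torsion_theory_MonGe0
    is_functor_pos_cone short_exact_pos_cone PreOrdGrp_simps(1))

end
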